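(* Let $R$ be a unital commutative ring with only finitely many maximal ideals, and let $M$ be a finitely generated $R$-module. Let $S$ be the set of maximal ideals $\mathfrak{m}$ of $R$ for which $\dim_{R/\mathfrak{m}} M/\mathfrak{m}M \geq 2$. If $S$ is nonempty, then $$\sigma(M) = \min_{\mathfrak{m} \in S} |R/\mathfrak{m}|+1$$ as cardinal numbers. If $S$ is empty, then $M$ is cyclic.
   Context: The covering number $\sigma(M)$ of an $R$-module $M$ is the smallest cardinal $\aleph$ (possibly infinite) such that $M$ is a union of $\aleph$-many proper $R$-submodules; it is defined when $M$ has some covering by proper submodules (the stated equality includes the assertion that such a covering exists). A module is cyclic if it is generated by one element. The expression $\min_{\mathfrak{m}\in S}|R/\mathfrak{m}|+1$ means the minimum over $\mathfrak{m}\in S$ of the cardinal $|R/\mathfrak{m}|+1$. *)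

theory Defs
  imports "HOL-Algebra.QuotRing" "Jordan_Normal_Form.Missing_VectorSpace"
begin

unbundle cardinal_syntax

section \<open>Finitely generated and cyclic modules\<close>

definition fin_gen_module :: "('a, 'r) ring_scheme \<Rightarrow> ('a, 'b, 'm) module_scheme \<Rightarrow> bool" where
  "fin_gen_module R M \<longleftrightarrow>
     (\<exists>A. finite A \<and> A \<subseteq> carrier M \<and> module.span R M A = carrier M)"

definition cyclic_module :: "('a, 'r) ring_scheme \<Rightarrow> ('a, 'b, 'm) module_scheme \<Rightarrow> bool" where
  "cyclic_module R M \<longleftrightarrow> (\<exists>x\<in>carrier M. module.span R M {x} = carrier M)"


section \<open>The $R/I$-module $M/IM$\<close>

definition ideal_smult :: "('a, 'r) ring_scheme \<Rightarrow> ('a, 'b, 'm) module_scheme \<Rightarrow> 'a set \<Rightarrow> 'b set" where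
  "ideal_smult R M I = module.span R M {a \<odot>\<^bsub>M\<^esub> x | a x. a \<in> I \<and> x \<in> carrier M}"

text \<open>The scalar multiplication is the analogue of \<^const>\<open>rcoset_mult\<close>: it satisfies
  $(a + I)(x + IM) = ax + IM$, see \<open>reduction_smult_rcos\<close> below.  The record type
  of modules extends that of rings; the fields \<^const>\<open>mult\<close> and \<^const>\<open>one\<close> play no role
  for modules and are filled with dummies.\<close>

definition reduction :: "('a, 'r) ring_scheme \<Rightarrow> ('a, 'b, 'm) module_scheme \<Rightarrow> 'a set \<Rightarrow> ('a set, 'b set) module"
  where
  "reduction R M I =
     \<lparr>carrier = a_rcosets\<^bsub>M\<^esub> (ideal_smult R M I),
      mult = (\<lambda>X Y. ideal_smult R M I), one = ideal_smult R M I,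
      zero = ideal_smult R M I, add = set_add M,
      smult = (\<lambda>A X. \<Union>a\<in>A. \<Union>x\<in>X. ideal_smult R M I +>\<^bsub>M\<^esub> (a \<odot>\<^bsub>M\<^esub> x))\<rparr>"


section \<open>Covering numbers\<close>

text \<open>Cardinals are represented as in \<^theory>\<open>HOL.BNF_Cardinal_Order_Relation\<close>, by cardinal
  well-orders up to the isomorphism \<open>=o\<close>.  Accordingly \<open>min_card X\<close> is determined up to
  \<open>=o\<close>, and is meaningful for nonempty \<open>X\<close> (see \<open>min_card\<close> below).\<close>

definition min_card :: "'c rel set \<Rightarrow> 'c rel" where
  "min_card X = (SOME r. r \<in> X \<and> (\<forall>s\<in>X. r \<le>o s))"

definition proper_submodule_cover ::
    "('a, 'r) ring_scheme \<Rightarrow> ('a, 'b, 'm) module_scheme \<Rightarrow> 'b set set \<Rightarrow> bool" where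
  "proper_submodule_cover R M C \<longleftrightarrow>
     (\<forall>N\<in>C. submodule R N M \<and> N \<noteq> carrier M) \<and> \<Union>C = carrier M"

text \<open>Meaningful only if some cover exists; statements about its value have to assert that
  separately.\<close>

definition covering_number :: "('a, 'r) ring_scheme \<Rightarrow> ('a, 'b, 'm) module_scheme \<Rightarrow> 'b set rel" where
  "covering_number R M = min_card {|C| | C. proper_submodule_cover R M C}"


section \<open>The definitions make sense\<close>

lemma min_card:
  assumes "X \<noteq> {}" and "\<And>r. r \<in> X \<Longrightarrow> Card_order r"
  shows "min_card X \<in> X" and "\<And>s. s \<in> X \<Longrightarrow> min_card X \<le>o s"
proof -
  have "\<exists>r. r \<in> X \<and> (\<forall>s\<in>X. r \<le>o s)"
    using exists_minim_Well_order[of X] assms card_order_on_well_order_on by blast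
  then have "min_card X \<in> X \<and> (\<forall>s\<in>X. min_card X \<le>o s)"
    unfolding min_card_def by (rule someI_ex)
  then show "min_card X \<in> X" and "\<And>s. s \<in> X \<Longrightarrow> min_card X \<le>o s" by auto
qed

context module
begin

lemma
  assumes "ideal I R"
  shows ideal_smult_submodule: "submodule R (ideal_smult R M I) M"
    and ideal_smult_mem: "\<lbrakk>a \<in> I; x \<in> carrier M\<rbrakk> \<Longrightarrow> a \<odot>\<^bsub>M\<^esub> x \<in> ideal_smult R M I"
proof -
  interpret I: ideal I R by fact
  let ?G = "{a \<odot>\<^bsub>M\<^esub> x | a x. a \<in> I \<and> x \<in> carrier M}"
  have G: "?G \<subseteq> carrier M" using I.Icarr by auto
  then show "submodule R (ideal_smult R M I) M"
    unfolding ideal_smult_def by (rule span_is_submodule)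
  show "a \<odot>\<^bsub>M\<^esub> x \<in> ideal_smult R M I" if "a \<in> I" "x \<in> carrier M"
    unfolding ideal_smult_def using in_own_span[OF G] that by auto
qed

lemma submodule_abelian_subgroup:
  assumes "submodule R N M"
  shows "abelian_subgroup N M"
proof -
  interpret N: submodule R N M by fact
  have "subgroup N (add_monoid M)"
  proof (rule add.subgroupI)
    show "\<ominus>\<^bsub>M\<^esub> x \<in> N" if "x \<in> N" for x
      using that N.smult_closed[of "\<ominus>\<^bsub>R\<^esub> \<one>\<^bsub>R\<^esub>" x] N.subset
      by (metis R.a_inv_closed R.one_closed smult_l_minus smult_one subsetD)
  qed (use N.subset N.zero_closed N.m_closed in blast)+
  then show ?thesis
    by (intro abelian_subgroupI3 additive_subgroup.intro M.abelian_group_axioms)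
qed

lemma reduction_smult_rcos:
  assumes "ideal I R" and "a \<in> carrier R" and "x \<in> carrier M"
  shows "(I +>\<^bsub>R\<^esub> a) \<odot>\<^bsub>reduction R M I\<^esub> (ideal_smult R M I +>\<^bsub>M\<^esub> x)
           = ideal_smult R M I +>\<^bsub>M\<^esub> (a \<odot>\<^bsub>M\<^esub> x)"
proof -
  interpret I: ideal I R by fact
  let ?N = "ideal_smult R M I"
  interpret N: submodule R ?N M by (rule ideal_smult_submodule) fact
  interpret S: abelian_subgroup ?N M by (rule submodule_abelian_subgroup) (rule N.submodule_axioms)
  have eq: "?N +>\<^bsub>M\<^esub> (b \<odot>\<^bsub>M\<^esub> y) = ?N +>\<^bsub>M\<^esub> (a \<odot>\<^bsub>M\<^esub> x)"
    if b: "b \<in> I +>\<^bsub>R\<^esub> a" and y: "y \<in> ?N +>\<^bsub>M\<^esub> x" for b y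
  proof -
    obtain h where h: "h \<in> I" "b = h \<oplus>\<^bsub>R\<^esub> a" using b by (auto simp: a_r_coset_def')
    obtain n where n: "n \<in> ?N" "y = n \<oplus>\<^bsub>M\<^esub> x" using y by (auto simp: a_r_coset_def')
    have hc: "h \<in> carrier R" using h I.Icarr by auto
    have nc: "n \<in> carrier M" using n N.subset by auto
    have yc: "y \<in> carrier M" using n nc assms by auto
    have "b \<odot>\<^bsub>M\<^esub> y = (h \<odot>\<^bsub>M\<^esub> y \<oplus>\<^bsub>M\<^esub> a \<odot>\<^bsub>M\<^esub> n) \<oplus>\<^bsub>M\<^esub> a \<odot>\<^bsub>M\<^esub> x"
      using hc nc yc assms
      by (simp add: h(2) smult_l_distr) (simp add: n(2) smult_r_distr M.a_assoc)
    moreover have "h \<odot>\<^bsub>M\<^esub> y \<oplus>\<^bsub>M\<^esub> a \<odot>\<^bsub>M\<^esub> n \<in> ?N"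
      using ideal_smult_mem[OF assms(1) h(1) yc] N.smult_closed[OF assms(2) n(1)] by (rule N.m_closed)
    ultimately have "b \<odot>\<^bsub>M\<^esub> y \<in> ?N +>\<^bsub>M\<^esub> (a \<odot>\<^bsub>M\<^esub> x)"
      by (auto simp: a_r_coset_def')
    then show ?thesis
      using S.a_repr_independence' assms by (metis smult_closed)
  qed
  have "a \<in> I +>\<^bsub>R\<^esub> a" "x \<in> ?N +>\<^bsub>M\<^esub> x"
    using assms I.a_rcos_self S.a_rcos_self by auto
  then have "(\<Union>b\<in>I +>\<^bsub>R\<^esub> a. \<Union>y\<in>?N +>\<^bsub>M\<^esub> x. ?N +>\<^bsub>M\<^esub> (b \<odot>\<^bsub>M\<^esub> y)) = ?N +>\<^bsub>M\<^esub> (a \<odot>\<^bsub>M\<^esub> x)"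
    using eq by blast
  then show ?thesis by (simp add: reduction_def)
qed

lemma reduction_module:
  assumes "ideal I R"
  shows "module (R Quot I) (reduction R M I)"
proof -
  interpret I: ideal I R by fact
  let ?N = "ideal_smult R M I" and ?Q = "reduction R M I"
  interpret N: submodule R ?N M by (rule ideal_smult_submodule) fact
  interpret S: abelian_subgroup ?N M by (rule submodule_abelian_subgroup) (rule N.submodule_axioms)
  have carrQ: "X \<in> carrier ?Q \<longleftrightarrow> (\<exists>x\<in>carrier M. X = ?N +>\<^bsub>M\<^esub> x)" for X
    by (auto simp: reduction_def A_RCOSETS_def')
  have carrR: "A \<in> carrier (R Quot I) \<longleftrightarrow> (\<exists>a\<in>carrier R. A = I +>\<^bsub>R\<^esub> a)" for A
    by (auto simp: FactRing_def A_RCOSETS_def')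
  have addQ: "(?N +>\<^bsub>M\<^esub> x) \<oplus>\<^bsub>?Q\<^esub> (?N +>\<^bsub>M\<^esub> y) = ?N +>\<^bsub>M\<^esub> (x \<oplus>\<^bsub>M\<^esub> y)"
    if "x \<in> carrier M" "y \<in> carrier M" for x y
    using that by (simp add: reduction_def S.a_rcos_sum)
  have addR: "(I +>\<^bsub>R\<^esub> a) \<oplus>\<^bsub>R Quot I\<^esub> (I +>\<^bsub>R\<^esub> b) = I +>\<^bsub>R\<^esub> (a \<oplus>\<^bsub>R\<^esub> b)"
    if "a \<in> carrier R" "b \<in> carrier R" for a b
    using that by (simp add: FactRing_def I.a_rcos_sum)
  have multR: "(I +>\<^bsub>R\<^esub> a) \<otimes>\<^bsub>R Quot I\<^esub> (I +>\<^bsub>R\<^esub> b) = I +>\<^bsub>R\<^esub> (a \<otimes>\<^bsub>R\<^esub> b)"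
    if "a \<in> carrier R" "b \<in> carrier R" for a b
    using that by (simp add: FactRing_def I.rcoset_mult_add)
  have oneR: "\<one>\<^bsub>R Quot I\<^esub> = I +>\<^bsub>R\<^esub> \<one>\<^bsub>R\<^esub>" by (simp add: FactRing_def)
  note smultQ = reduction_smult_rcos[OF assms]
  have zeroQ: "\<zero>\<^bsub>?Q\<^esub> = ?N +>\<^bsub>M\<^esub> \<zero>\<^bsub>M\<^esub>"
    by (simp add: reduction_def N.subset)
  have "abelian_group ?Q"
  proof (rule abelian_groupI)
    fix X assume "X \<in> carrier ?Q"
    then obtain x where x: "x \<in> carrier M" "X = ?N +>\<^bsub>M\<^esub> x" by (auto simp: carrQ)
    have "(?N +>\<^bsub>M\<^esub> (\<ominus>\<^bsub>M\<^esub> x)) \<oplus>\<^bsub>?Q\<^esub> X = \<zero>\<^bsub>?Q\<^esub>"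
      using x by (simp add: addQ zeroQ M.l_neg)
    then show "\<exists>Y\<in>carrier ?Q. Y \<oplus>\<^bsub>?Q\<^esub> X = \<zero>\<^bsub>?Q\<^esub>"
      using x by (meson M.a_inv_closed carrQ)
  qed (auto simp: carrQ addQ zeroQ M.a_ac)
  then show ?thesis
  proof (intro moduleI I.quotient_is_cring R.is_cring)
  qed (auto simp: carrQ carrR addQ addR multR oneR smultQ smult_l_distr smult_r_distr smult_assoc1)
qed

lemma reduction_vectorspace:
  assumes "maximalideal I R"
  shows "vectorspace (R Quot I) (reduction R M I)"
proof -
  interpret I: maximalideal I R by fact
  show ?thesis
    by (intro vectorspace.intro reduction_module I.is_ideal I.quotient_is_field R.is_cring)
qed

end

end

theory Submission
  imports Defs
begin

text \<open>
The problem is reduced to the vector spaces $M/\mathfrak m M$, one for each maximal ideal.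

Upper bound.  If $M/\mathfrak m M$ is not generated by one element, an irredundant generating set
modulo $\mathfrak m M$ contains two elements $x \ne y$.  Killing the other generators maps $M$
onto a plane over the field $R/\mathfrak m$, and a plane is the union of its $|R/\mathfrak m| + 1$
lines through the origin (\<open>exists_cover_if_noncyclic_modulo\<close>).

Lower bound.  Suppose the family $C$ covers $M$ and $|C| < |R/\mathfrak m| + 1$ for every
$\mathfrak m$ in $S$.  By Nakayama each member $W$ of $C$ satisfies $W + \mathfrak m M \ne M$ for
some maximal $\mathfrak m$ (\<open>exists_proper_reduction\<close>).  For each $\mathfrak m$ there is an
element $x_{\mathfrak m}$ outside all the proper $W + \mathfrak m M$: for $\mathfrak m \notin S$ a
generator of $M$ modulo $\mathfrak m M$ will do, and for $\mathfrak m \in S$ there are too few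
subspaces to cover $M/\mathfrak m M$ (\<open>exists_avoiding_element\<close>).  As there are finitely many
maximal ideals, the Chinese remainder theorem provides one $y$ congruent to $x_{\mathfrak m}$
modulo $\mathfrak m M$ for all $\mathfrak m$ at once, and $y$ lies in no member of $C$.

The same argument settles the case $S = \emptyset$: then no cover by proper submodules exists at
all, whereas a module that is not cyclic is covered by its cyclic submodules.

The counting argument is the same for finite and infinite residue fields: it is about the
$|R/\mathfrak m| + 1$ points of a projective line, of which a subspace that does not contain the
line contains at most one, and this yields an injection of the points into the cover.

The quotients $M/\mathfrak m M$ themselves only enter through \<open>dim_reduction_ge_2_iff\<close>, which turns
membership in $S$ into the condition that no single element generates $M$ modulo $\mathfrak m M$.
\<close>

section \<open>Maximal ideals\<close>

context cring
begin

lemma ideal_of_closed: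
  assumes "I \<subseteq> carrier R" and "\<zero> \<in> I"
    and add: "\<And>a b. \<lbrakk>a \<in> I; b \<in> I\<rbrakk> \<Longrightarrow> a \<oplus> b \<in> I"
    and mult: "\<And>r a. \<lbrakk>r \<in> carrier R; a \<in> I\<rbrakk> \<Longrightarrow> r \<otimes> a \<in> I"
  shows "ideal I R"
proof (rule idealI)
  show "ring R" by (rule ring_axioms)
  show "subgroup I (add_monoid R)"
  proof (rule add.subgroupI)
    fix a assume a: "a \<in> I"
    then have "\<ominus> a = \<ominus> \<one> \<otimes> a" using assms(1) by (auto simp: l_minus)
    then show "\<ominus> a \<in> I" using mult[of "\<ominus> \<one>" a] a by simp
  qed (use assms in auto)
  fix a r assume "a \<in> I" "r \<in> carrier R"
  then show "r \<otimes> a \<in> I" "a \<otimes> r \<in> I" using assms(1) mult[of r a] by (auto simp: m_comm)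
qed

text \<open>Zorn's lemma, applied to the ideals above $I$ that avoid \<open>\<one>\<close>; avoiding \<open>\<one>\<close> is what
makes properness pass to unions of chains.\<close>

lemma exists_maximalideal_above:
  assumes "ideal I R" and "\<one> \<notin> I"
  shows "\<exists>\<mm>. maximalideal \<mm> R \<and> I \<subseteq> \<mm>"
proof -
  let ?P = "{J. ideal J R \<and> I \<subseteq> J \<and> \<one> \<notin> J}"
  have "\<exists>\<mm>\<in>?P. \<forall>J\<in>?P. \<mm> \<subseteq> J \<longrightarrow> J = \<mm>"
  proof (rule subset_Zorn_nonempty)
    show "?P \<noteq> {}" using assms by auto
    fix C assume C: "C \<noteq> {}" "subset.chain ?P C"
    have P: "ideal J R" "I \<subseteq> J" "\<one> \<notin> J" if "J \<in> C" for J
      using C(2) that by (auto simp: subset.chain_def)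
    have sub: "J \<subseteq> carrier R" if "J \<in> C" for J
      using ideal.Icarr[OF P(1)[OF that]] by blast
    have "ideal (\<Union>C) R"
    proof (rule ideal_of_closed)
      show "\<Union>C \<subseteq> carrier R" using sub by auto
      show "\<zero> \<in> \<Union>C"
        using C(1) P(1) additive_subgroup.zero_closed[OF ideal.axioms(1)] by blast
    next
      fix a b assume "a \<in> \<Union>C" "b \<in> \<Union>C"
      then obtain J K where JK: "J \<in> C" "a \<in> J" "K \<in> C" "b \<in> K" by auto
      \<comment> \<open>In a chain the larger of the two ideals contains both summands.\<close>
      then have "J \<union> K \<in> C"
        using C(2) by (metis subset_chain_def subset_Un_eq sup.absorb_iff1)
      moreover have "a \<oplus> b \<in> J \<union> K"
        using additive_subgroup.a_closed[OF ideal.axioms(1)[OF P(1)[OF \<open>J \<union> K \<in> C\<close>]]] JK by blast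
      ultimately show "a \<oplus> b \<in> \<Union>C" by blast
    next
      fix r a assume "r \<in> carrier R" "a \<in> \<Union>C"
      then show "r \<otimes> a \<in> \<Union>C" using ideal.I_l_closed[OF P(1)] by blast
    qed
    then show "\<Union>C \<in> ?P" using C(1) P by blast
  qed
  then obtain \<mm> where "\<mm> \<in> ?P" and max': "\<forall>J\<in>?P. \<mm> \<subseteq> J \<longrightarrow> J = \<mm>"
    by (elim bexE)
  then have \<mm>: "ideal \<mm> R" "I \<subseteq> \<mm>" "\<one> \<notin> \<mm>" by simp_all
  have "maximalideal \<mm> R"
  proof (rule maximalidealI)
    show "carrier R \<noteq> \<mm>" using \<mm>(3) by auto
    fix J assume J: "ideal J R" "\<mm> \<subseteq> J" "J \<subseteq> carrier R"
    show "J = \<mm> \<or> J = carrier R"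
    proof (cases "\<one> \<in> J")
      case True
      then show ?thesis using ideal.one_imp_carrier[OF J(1)] by simp
    next
      case False
      then have "J \<in> ?P" using J \<mm>(2) by simp
      then show ?thesis using max' J(2) by simp
    qed
  qed (rule \<mm>(1))
  then show ?thesis using \<mm>(2) by blast
qed

lemma maximalideal_one_notin:
  assumes "maximalideal \<mm> R"
  shows "\<one> \<notin> \<mm>"
  using ideal.one_imp_carrier maximalideal.I_notcarr maximalideal.axioms(1) assms by metis

text \<open>Elements outside $\mathfrak m$ are units modulo $\mathfrak m$, since $\mathfrak m + Rr = R$.\<close>

lemma maximalideal_inverse:
  assumes "maximalideal \<mm> R" and "r \<in> carrier R" and "r \<notin> \<mm>"
  obtains s where "s \<in> carrier R" and "\<one> \<ominus> s \<otimes> r \<in> \<mm>"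
proof -
  interpret maximalideal \<mm> R by fact
  let ?J = "{a \<oplus> s \<otimes> r | a s. a \<in> \<mm> \<and> s \<in> carrier R}"
  have "ideal ?J R"
  proof (rule ideal_of_closed)
    show "?J \<subseteq> carrier R" using assms Icarr by auto
    have "\<zero> = \<zero> \<oplus> \<zero> \<otimes> r" using assms by simp
    then show "\<zero> \<in> ?J" using additive_subgroup.zero_closed[OF is_additive_subgroup] by blast
  next
    fix x y assume "x \<in> ?J" "y \<in> ?J"
    then obtain a s b t where x: "x = a \<oplus> s \<otimes> r" "a \<in> \<mm>" "s \<in> carrier R"
      and y: "y = b \<oplus> t \<otimes> r" "b \<in> \<mm>" "t \<in> carrier R" by auto
    have "x \<oplus> y = (a \<oplus> b) \<oplus> (s \<oplus> t) \<otimes> r"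
      using x y assms Icarr by (simp add: l_distr a_ac)
    then show "x \<oplus> y \<in> ?J" using x y by blast
  next
    fix c x assume c: "c \<in> carrier R" and "x \<in> ?J"
    then obtain a s where x: "x = a \<oplus> s \<otimes> r" "a \<in> \<mm>" "s \<in> carrier R" by auto
    have "c \<otimes> x = c \<otimes> a \<oplus> (c \<otimes> s) \<otimes> r"
      using x c assms Icarr by (simp add: r_distr m_assoc)
    then show "c \<otimes> x \<in> ?J" using x c I_l_closed by blast
  qed
  moreover have "\<mm> \<subseteq> ?J"
  proof
    fix a assume "a \<in> \<mm>"
    moreover from this have "a = a \<oplus> \<zero> \<otimes> r" using assms Icarr by simp
    ultimately show "a \<in> ?J" by blast
  qed
  moreover have "r \<in> ?J"
  proof -
    have "r = \<zero> \<oplus> \<one> \<otimes> r" using assms by simp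
    then show ?thesis using additive_subgroup.zero_closed[OF is_additive_subgroup] by blast
  qed
  ultimately have "?J = carrier R"
    using I_maximal[of ?J] assms(3) ideal.Icarr[of ?J R] by blast
  then obtain a s where a: "\<one> = a \<oplus> s \<otimes> r" "a \<in> \<mm>" "s \<in> carrier R" by blast
  then have "\<one> \<ominus> s \<otimes> r = a"
    using assms Icarr by (simp add: a_minus_def a_assoc r_neg)
  then show thesis using that a by blast
qed

text \<open>The ring-theoretic half of the Chinese remainder theorem: $e$ represents the element of
$\prod_{\mathfrak n} R/\mathfrak n$ that is $1$ at $\mathfrak m$ and $0$ at the members of $T$.  It is
a product with one factor per $\mathfrak n \in T$, each in $\mathfrak n$ and congruent to $1$
modulo $\mathfrak m$.\<close>

lemma exists_idempotent_approximation:
  assumes "finite T" and "\<And>\<nn>. \<nn> \<in> T \<Longrightarrow> maximalideal \<nn> R"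
    and \<mm>: "maximalideal \<mm> R" and "\<mm> \<notin> T"
  shows "\<exists>e\<in>carrier R. (\<forall>\<nn>\<in>T. e \<in> \<nn>) \<and> \<one> \<ominus> e \<in> \<mm>"
  using assms(1,2,4)
proof (induction T rule: finite_induct)
  case empty
  interpret \<mm>: maximalideal \<mm> R by fact
  have "\<one> \<ominus> \<one> \<in> \<mm>" using \<mm>.zero_closed by (simp add: r_neg minus_eq)
  then show ?case by auto
next
  case (insert \<nn> T)
  interpret \<mm>: maximalideal \<mm> R by fact
  interpret \<nn>: maximalideal \<nn> R using insert.prems by simp
  obtain e where e: "e \<in> carrier R" "\<forall>\<nn>\<in>T. e \<in> \<nn>" "\<one> \<ominus> e \<in> \<mm>"
    using insert by auto
  have "\<not> \<nn> \<subseteq> \<mm>"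
  proof
    assume "\<nn> \<subseteq> \<mm>"
    then have "\<mm> = \<nn> \<or> \<mm> = carrier R"
      using \<nn>.I_maximal[OF \<mm>.is_ideal] \<mm>.Icarr by blast
    then show False using insert.prems(2) \<mm>.I_notcarr by auto
  qed
  then obtain f where f: "f \<in> \<nn>" "f \<notin> \<mm>" by auto
  then have fc: "f \<in> carrier R" using \<nn>.Icarr by auto
  obtain g where g: "g \<in> carrier R" "\<one> \<ominus> g \<otimes> f \<in> \<mm>"
    by (rule maximalideal_inverse[OF \<mm> fc f(2)])
  have "\<one> \<ominus> e \<otimes> (g \<otimes> f) = (\<one> \<ominus> e) \<oplus> e \<otimes> (\<one> \<ominus> g \<otimes> f)"
    using e(1) g(1) fc by algebra
  also have "\<dots> \<in> \<mm>" using e g \<mm>.I_l_closed \<mm>.a_closed by blast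
  finally have "\<one> \<ominus> e \<otimes> (g \<otimes> f) \<in> \<mm>" .
  moreover have "e \<otimes> (g \<otimes> f) \<in> \<nn>" using e(1) g(1) f(1) \<nn>.I_l_closed by blast
  moreover have "e \<otimes> (g \<otimes> f) \<in> \<nn>'" if "\<nn>' \<in> T" for \<nn>'
  proof -
    interpret \<nn>': maximalideal \<nn>' R using insert.prems(1) that by simp
    show ?thesis using that e(2) fc g(1) by (intro \<nn>'.I_r_closed) auto
  qed
  ultimately show ?case using e(1) g(1) fc by blast
qed

text \<open>A transversal of the cosets of $I$, used to label points on a line by elements of the
residue field while computing in $R$ and $M$ only.\<close>

lemma quotient_representatives:
  assumes "ideal I R"
  obtains rep where "\<And>K. K \<in> carrier (R Quot I) \<Longrightarrow> rep K \<in> carrier R"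
    and "\<And>K L. \<lbrakk>K \<in> carrier (R Quot I); L \<in> carrier (R Quot I); rep K \<ominus> rep L \<in> I\<rbrakk> \<Longrightarrow> K = L"
    and "\<And>r. r \<in> carrier R \<Longrightarrow> \<exists>K\<in>carrier (R Quot I). r \<ominus> rep K \<in> I"
proof -
  have "\<forall>K\<in>carrier (R Quot I). \<exists>r\<in>carrier R. K = I +> r"
    by (auto simp: FactRing_def A_RCOSETS_def')
  then obtain rep where rep: "\<And>K. K \<in> carrier (R Quot I) \<Longrightarrow> rep K \<in> carrier R \<and> K = I +> rep K"
    by metis
  have coset: "I +> r \<in> carrier (R Quot I)" if "r \<in> carrier R" for r
    using that by (auto simp: FactRing_def A_RCOSETS_def')
  show thesis
  proof (rule that)
    show "rep K \<in> carrier R" if "K \<in> carrier (R Quot I)" for K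
      using rep that by blast
    show "K = L" if "K \<in> carrier (R Quot I)" "L \<in> carrier (R Quot I)" "rep K \<ominus> rep L \<in> I" for K L
      using that rep quotient_eq_iff_same_a_r_cos[OF assms] by metis
    show "\<exists>K\<in>carrier (R Quot I). r \<ominus> rep K \<in> I" if "r \<in> carrier R" for r
      using that rep coset quotient_eq_iff_same_a_r_cos[OF assms] by metis
  qed
qed

end

context module
begin

section \<open>Submodules and spans\<close>

text \<open>The submodule $N + Ix$.  For $I = R$ it is the span of \<open>insert x N\<close>; Nakayama needs it
for $I$ a maximal ideal.\<close>

lemma submodule_plus_ideal_multiples:
  assumes "submodule R N M" and "ideal I R" and "x \<in> carrier M"
  shows "submodule R {u \<oplus>\<^bsub>M\<^esub> r \<odot>\<^bsub>M\<^esub> x | u r. u \<in> N \<and> r \<in> I} M" (is "submodule R ?K M")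
proof -
  interpret N: submodule R N M by fact
  interpret I: ideal I R by fact
  have Nc: "u \<in> carrier M" if "u \<in> N" for u using N.subset that by blast
  show ?thesis
  proof
    show "?K \<subseteq> carrier M" using assms(3) Nc I.Icarr by auto
    have "\<zero>\<^bsub>M\<^esub> = \<zero>\<^bsub>M\<^esub> \<oplus>\<^bsub>M\<^esub> \<zero>\<^bsub>R\<^esub> \<odot>\<^bsub>M\<^esub> x" using assms(3) by simp
    then show "\<zero>\<^bsub>M\<^esub> \<in> ?K" by (auto intro: N.zero_closed I.zero_closed)
  next
    fix v w assume "v \<in> ?K" "w \<in> ?K"
    then obtain u r u' r' where v: "v = u \<oplus>\<^bsub>M\<^esub> r \<odot>\<^bsub>M\<^esub> x" "u \<in> N" "r \<in> I"
      and w: "w = u' \<oplus>\<^bsub>M\<^esub> r' \<odot>\<^bsub>M\<^esub> x" "u' \<in> N" "r' \<in> I" by auto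
    have "v \<oplus>\<^bsub>M\<^esub> w = (u \<oplus>\<^bsub>M\<^esub> u') \<oplus>\<^bsub>M\<^esub> (r \<oplus>\<^bsub>R\<^esub> r') \<odot>\<^bsub>M\<^esub> x"
      using v w assms(3) Nc I.Icarr by (simp add: smult_l_distr M.a_ac)
    then show "v \<oplus>\<^bsub>M\<^esub> w \<in> ?K" using v w by blast
  next
    fix c v assume c: "c \<in> carrier R" and "v \<in> ?K"
    then obtain u r where v: "v = u \<oplus>\<^bsub>M\<^esub> r \<odot>\<^bsub>M\<^esub> x" "u \<in> N" "r \<in> I" by auto
    have "c \<odot>\<^bsub>M\<^esub> v = c \<odot>\<^bsub>M\<^esub> u \<oplus>\<^bsub>M\<^esub> (c \<otimes>\<^bsub>R\<^esub> r) \<odot>\<^bsub>M\<^esub> x"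
      using v c assms(3) Nc I.Icarr by (simp add: smult_r_distr smult_assoc1)
    then show "c \<odot>\<^bsub>M\<^esub> v \<in> ?K" using v c I.I_l_closed by blast
  qed
qed

lemma span_insert_submodule:
  assumes "submodule R N M" and "x \<in> carrier M"
  shows "span (insert x N) = {u \<oplus>\<^bsub>M\<^esub> r \<odot>\<^bsub>M\<^esub> x | u r. u \<in> N \<and> r \<in> carrier R}" (is "_ = ?K")
proof
  interpret N: submodule R N M by fact
  have K: "submodule R ?K M"
    using submodule_plus_ideal_multiples[OF assms(1) R.oneideal assms(2)] .
  have sub: "insert x N \<subseteq> carrier M" using assms(2) N.subset by auto
  have "insert x N \<subseteq> ?K"
  proof
    fix v assume "v \<in> insert x N"
    then consider "v = \<zero>\<^bsub>M\<^esub> \<oplus>\<^bsub>M\<^esub> \<one>\<^bsub>R\<^esub> \<odot>\<^bsub>M\<^esub> x" | "v = v \<oplus>\<^bsub>M\<^esub> \<zero>\<^bsub>R\<^esub> \<odot>\<^bsub>M\<^esub> x" "v \<in> N"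
      using assms(2) sub by auto
    then show "v \<in> ?K" by cases (blast intro: N.zero_closed)+
  qed
  then show "span (insert x N) \<subseteq> ?K" by (rule span_is_subset[OF _ K])
  interpret S: submodule R "span (insert x N)" M by (rule span_is_submodule[OF sub])
  show "?K \<subseteq> span (insert x N)" using in_own_span[OF sub] by auto
qed

lemma span_idem_insert:
  assumes "insert x A \<subseteq> carrier M"
  shows "span (insert x (span A)) = span (insert x A)"
proof
  have A: "A \<subseteq> carrier M" using assms by simp
  interpret S: submodule R "span (insert x A)" M by (rule span_is_submodule[OF assms])
  interpret T: submodule R "span A" M by (rule span_is_submodule[OF A])
  have "insert x (span A) \<subseteq> span (insert x A)"
    using in_own_span[OF assms] span_is_monotone[of A "insert x A"] by blast
  then show "span (insert x (span A)) \<subseteq> span (insert x A)"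
    by (rule span_is_subset) (rule S.submodule_axioms)
  show "span (insert x A) \<subseteq> span (insert x (span A))"
    using in_own_span[OF A] by (intro span_is_monotone) blast
qed

lemma submodule_minus:
  assumes "submodule R N M" and "v \<in> N" and "w \<in> N"
  shows "v \<ominus>\<^bsub>M\<^esub> w \<in> N"
proof -
  interpret abelian_subgroup N M by (rule submodule_abelian_subgroup) fact
  show ?thesis using assms by (simp add: a_minus_def)
qed

lemma ideal_colon:
  assumes "submodule R N M" and "x \<in> carrier M"
  shows "ideal {r \<in> carrier R. r \<odot>\<^bsub>M\<^esub> x \<in> N} R"
proof -
  interpret N: submodule R N M by fact
  show ?thesis
    using assms(2) by (intro R.ideal_of_closed) (auto simp: smult_l_distr smult_assoc1)
qed

lemma smult_diff:
  assumes "a \<in> carrier R" "b \<in> carrier R" "x \<in> carrier M"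
  shows "(a \<ominus>\<^bsub>R\<^esub> b) \<odot>\<^bsub>M\<^esub> x = a \<odot>\<^bsub>M\<^esub> x \<ominus>\<^bsub>M\<^esub> b \<odot>\<^bsub>M\<^esub> x"
  using assms by (simp add: R.minus_eq M.minus_eq smult_l_distr smult_l_minus)

text \<open>A submodule containing $\mathfrak m M$ is the preimage of an $R/\mathfrak m$-subspace, so
scalars outside $\mathfrak m$ can be cancelled.\<close>

lemma mem_of_unit_multiple_mem:
  assumes \<mm>: "maximalideal \<mm> R" and W: "submodule R W M" and sub: "ideal_smult R M \<mm> \<subseteq> W"
    and r: "r \<in> carrier R" "r \<notin> \<mm>" and v: "v \<in> carrier M" "r \<odot>\<^bsub>M\<^esub> v \<in> W"
  shows "v \<in> W"
proof -
  interpret W: submodule R W M by fact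
  obtain s where s: "s \<in> carrier R" "\<one>\<^bsub>R\<^esub> \<ominus>\<^bsub>R\<^esub> s \<otimes>\<^bsub>R\<^esub> r \<in> \<mm>"
    by (rule R.maximalideal_inverse[OF \<mm> r])
  have "v = (\<one>\<^bsub>R\<^esub> \<ominus>\<^bsub>R\<^esub> s \<otimes>\<^bsub>R\<^esub> r) \<odot>\<^bsub>M\<^esub> v \<oplus>\<^bsub>M\<^esub> s \<odot>\<^bsub>M\<^esub> (r \<odot>\<^bsub>M\<^esub> v)"
    using s(1) r v(1) by (simp add: smult_diff smult_assoc1 M.minus_eq M.a_assoc M.l_neg)
  moreover have "(\<one>\<^bsub>R\<^esub> \<ominus>\<^bsub>R\<^esub> s \<otimes>\<^bsub>R\<^esub> r) \<odot>\<^bsub>M\<^esub> v \<in> W"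
    using ideal_smult_mem[OF maximalideal.axioms(1)[OF \<mm>] s(2) v(1)] sub by blast
  ultimately show ?thesis using W.m_closed W.smult_closed[OF s(1) v(2)] by metis
qed

text \<open>A generating set modulo $N$ of least cardinality is irredundant.  In
Nakayama's lemma it provides a nonzero cyclic quotient of $M/N$; for $N = \mathfrak m M$ it is the
choice of a basis of $M/\mathfrak m M$.\<close>

lemma exists_irredundant_generators_modulo:
  assumes fg: "fin_gen_module R M" and N: "submodule R N M"
  obtains A where "finite A" and "A \<subseteq> carrier M" and "span (A \<union> N) = carrier M"
    and "\<And>z. z \<in> A \<Longrightarrow> z \<notin> span (A - {z} \<union> N)"
proof -
  interpret N: submodule R N M by fact
  let ?P = "\<lambda>A. finite A \<and> A \<subseteq> carrier M \<and> span (A \<union> N) = carrier M"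
  obtain A0 where A0: "finite A0" "A0 \<subseteq> carrier M" "span A0 = carrier M"
    using fg unfolding fin_gen_module_def by auto
  have "?P A0"
    using A0 span_is_monotone[of A0 "A0 \<union> N"] span_is_subset2[of "A0 \<union> N"] N.subset by auto
  then obtain A where A: "?P A" and least: "\<And>B. ?P B \<Longrightarrow> card A \<le> card B"
    using exists_least_iff[of "\<lambda>n. \<exists>A. ?P A \<and> card A = n"] by (metis not_le)
  have "z \<notin> span (A - {z} \<union> N)" if z: "z \<in> A" for z
  proof
    assume red: "z \<in> span (A - {z} \<union> N)"
    have sub: "A - {z} \<union> N \<subseteq> carrier M" using A N.subset by blast
    have "A \<union> N \<subseteq> span (A - {z} \<union> N)" using red in_own_span[OF sub] by blast
    then have "span (A \<union> N) \<subseteq> span (A - {z} \<union> N)"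
      by (rule span_is_subset) (rule span_is_submodule[OF sub])
    then have "span (A - {z} \<union> N) = carrier M" using A span_is_subset2[OF sub] by blast
    then have "card A \<le> card (A - {z})" using A by (intro least) blast
    then show False using A z card_Diff1_less[of A z] by simp
  qed
  then show thesis using that A by blast
qed

section \<open>Nakayama and the Chinese remainder theorem\<close>

text \<open>Nakayama's lemma for $M/N$.  Let $a$ be one of an irredundant set of generators modulo $N$,
and $L$ the span of $N$ and the others, so that $M/L \ne 0$ is cyclic, generated by $a$.  Its
annihilator is a proper ideal, hence contained in some maximal $\mathfrak m$.  If
$a \in L + \mathfrak m a = L + \mathfrak m M$, then $1 - t$ annihilates $a$ modulo $L$ for some
$t \in \mathfrak m$, which would put $1$ into $\mathfrak m$.\<close>

lemma exists_proper_reduction: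
  assumes fg: "fin_gen_module R M" and N: "submodule R N M" and ne: "N \<noteq> carrier M"
  shows "\<exists>\<mm>. maximalideal \<mm> R \<and> span (N \<union> ideal_smult R M \<mm>) \<noteq> carrier M"
proof -
  interpret N: submodule R N M by fact
  obtain A where A: "A \<subseteq> carrier M" "span (A \<union> N) = carrier M"
    and irredundant: "\<And>z. z \<in> A \<Longrightarrow> z \<notin> span (A - {z} \<union> N)"
    by (rule exists_irredundant_generators_modulo[OF fg N]) blast
  have "A \<noteq> {}" using A ne span_is_subset[OF order_refl N] in_own_span[OF N.subset] by auto
  then obtain a where a: "a \<in> A" by blast
  define L where "L = span (A - {a} \<union> N)"
  have Bsub: "A - {a} \<union> N \<subseteq> carrier M" and ac: "a \<in> carrier M" using A N.subset a by auto
  interpret L: submodule R L M unfolding L_def by (rule span_is_submodule[OF Bsub])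
  have L: "submodule R L M" ..
  have NL: "N \<subseteq> L" using in_own_span[OF Bsub] unfolding L_def by blast
  have "insert a (A - {a} \<union> N) = A \<union> N" using a by auto
  then have gen: "span (insert a L) = carrier M"
    unfolding L_def using span_idem_insert[of a "A - {a} \<union> N"] Bsub ac A by simp
  have "a \<notin> L" unfolding L_def by (rule irredundant[OF a])
  then have "\<one>\<^bsub>R\<^esub> \<notin> {r \<in> carrier R. r \<odot>\<^bsub>M\<^esub> a \<in> L}" using ac by simp
  then obtain \<mm> where \<mm>: "maximalideal \<mm> R" and colon: "{r \<in> carrier R. r \<odot>\<^bsub>M\<^esub> a \<in> L} \<subseteq> \<mm>"
    using R.exists_maximalideal_above[OF ideal_colon[OF L ac]] by blast
  interpret \<mm>: maximalideal \<mm> R by fact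
  let ?K = "{u \<oplus>\<^bsub>M\<^esub> t \<odot>\<^bsub>M\<^esub> a | u t. u \<in> L \<and> t \<in> \<mm>}"
  have K: "submodule R ?K M" using submodule_plus_ideal_multiples[OF L \<mm>.is_ideal ac] .
  have "{t \<odot>\<^bsub>M\<^esub> x | t x. t \<in> \<mm> \<and> x \<in> carrier M} \<subseteq> ?K"
  proof clarify
    fix t x assume t: "t \<in> \<mm>" and "x \<in> carrier M"
    then have "x \<in> span (insert a L)" using gen by simp
    then obtain u s where x: "x = u \<oplus>\<^bsub>M\<^esub> s \<odot>\<^bsub>M\<^esub> a" "u \<in> L" "s \<in> carrier R"
      unfolding span_insert_submodule[OF L ac] by blast
    have tc: "t \<in> carrier R" using t \<mm>.Icarr by auto
    have "t \<odot>\<^bsub>M\<^esub> x = t \<odot>\<^bsub>M\<^esub> u \<oplus>\<^bsub>M\<^esub> (t \<otimes>\<^bsub>R\<^esub> s) \<odot>\<^bsub>M\<^esub> a"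
      using x ac tc L.subset by (auto simp: smult_r_distr smult_assoc1 subset_iff)
    moreover have "t \<odot>\<^bsub>M\<^esub> u \<in> L" "t \<otimes>\<^bsub>R\<^esub> s \<in> \<mm>" using x t tc \<mm>.I_r_closed by auto
    ultimately show "\<exists>u' t'. t \<odot>\<^bsub>M\<^esub> x = u' \<oplus>\<^bsub>M\<^esub> t' \<odot>\<^bsub>M\<^esub> a \<and> u' \<in> L \<and> t' \<in> \<mm>" by blast
  qed
  then have mK: "ideal_smult R M \<mm> \<subseteq> ?K" unfolding ideal_smult_def by (rule span_is_subset[OF _ K])
  have "L \<subseteq> ?K"
  proof
    fix u assume "u \<in> L"
    moreover from this have "u = u \<oplus>\<^bsub>M\<^esub> \<zero>\<^bsub>R\<^esub> \<odot>\<^bsub>M\<^esub> a" using ac L.subset by auto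
    ultimately show "u \<in> ?K" using \<mm>.zero_closed by blast
  qed
  then have "N \<union> ideal_smult R M \<mm> \<subseteq> ?K" using NL mK by blast
  then have "span (N \<union> ideal_smult R M \<mm>) \<subseteq> ?K" by (rule span_is_subset[OF _ K])
  moreover have "a \<notin> ?K"
  proof
    assume "a \<in> ?K"
    then obtain u t where a: "a = u \<oplus>\<^bsub>M\<^esub> t \<odot>\<^bsub>M\<^esub> a" "u \<in> L" "t \<in> \<mm>" by auto
    have tc: "t \<in> carrier R" and uc: "u \<in> carrier M" using a \<mm>.Icarr L.subset by auto
    have "(\<one>\<^bsub>R\<^esub> \<ominus>\<^bsub>R\<^esub> t) \<odot>\<^bsub>M\<^esub> a = a \<ominus>\<^bsub>M\<^esub> t \<odot>\<^bsub>M\<^esub> a"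
      using tc ac by (simp add: R.minus_eq M.minus_eq smult_l_distr smult_l_minus)
    also have "\<dots> = u"
    proof -
      have "a \<ominus>\<^bsub>M\<^esub> t \<odot>\<^bsub>M\<^esub> a = (u \<oplus>\<^bsub>M\<^esub> t \<odot>\<^bsub>M\<^esub> a) \<ominus>\<^bsub>M\<^esub> t \<odot>\<^bsub>M\<^esub> a" using a(1) by simp
      then show ?thesis using tc uc ac by (simp add: M.minus_eq M.a_assoc M.r_neg)
    qed
    finally have "\<one>\<^bsub>R\<^esub> \<ominus>\<^bsub>R\<^esub> t \<in> \<mm>" using colon a(2) tc by auto
    then have "(\<one>\<^bsub>R\<^esub> \<ominus>\<^bsub>R\<^esub> t) \<oplus>\<^bsub>R\<^esub> t \<in> \<mm>" using a(3) by (rule \<mm>.a_closed)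
    then have "\<one>\<^bsub>R\<^esub> \<in> \<mm>" using tc by (simp add: R.minus_eq R.a_assoc R.l_neg)
    then show False using R.maximalideal_one_notin[OF \<mm>] by blast
  qed
  ultimately show ?thesis using \<mm> ac by blast
qed

text \<open>Chinese remainder theorem for $M$: a solution $y$ for $T$ is corrected at a further maximal
ideal $\mathfrak m$ to $y + e(x_{\mathfrak m} - y)$, where $e$ vanishes modulo the members of $T$ and
is $1$ modulo $\mathfrak m$.\<close>

lemma exists_simultaneous_congruence:
  assumes "finite T" and "\<And>\<nn>. \<nn> \<in> T \<Longrightarrow> maximalideal \<nn> R"
    and "\<And>\<nn>. \<nn> \<in> T \<Longrightarrow> x \<nn> \<in> carrier M"
  shows "\<exists>y\<in>carrier M. \<forall>\<nn>\<in>T. y \<ominus>\<^bsub>M\<^esub> x \<nn> \<in> ideal_smult R M \<nn>"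
  using assms
proof (induction T rule: finite_induct)
  case empty
  then show ?case by auto
next
  case (insert \<mm> T)
  then obtain y where y: "y \<in> carrier M" "\<forall>\<nn>\<in>T. y \<ominus>\<^bsub>M\<^esub> x \<nn> \<in> ideal_smult R M \<nn>"
    by auto
  have \<mm>: "maximalideal \<mm> R" and xc: "x \<mm> \<in> carrier M" using insert.prems by auto
  obtain e where e: "e \<in> carrier R" "\<forall>\<nn>\<in>T. e \<in> \<nn>" "\<one>\<^bsub>R\<^esub> \<ominus>\<^bsub>R\<^esub> e \<in> \<mm>"
    using R.exists_idempotent_approximation[OF insert.hyps(1) _ \<mm> insert.hyps(2)] insert.prems(1)
    by auto
  define z where "z = y \<oplus>\<^bsub>M\<^esub> e \<odot>\<^bsub>M\<^esub> (x \<mm> \<ominus>\<^bsub>M\<^esub> y)"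
  have "z \<ominus>\<^bsub>M\<^esub> x \<nn> \<in> ideal_smult R M \<nn>" if n: "\<nn> \<in> T" for \<nn>
  proof -
    have \<nn>: "ideal \<nn> R" and nc: "x \<nn> \<in> carrier M"
      using insert.prems n maximalideal.axioms(1) by auto
    have "z \<ominus>\<^bsub>M\<^esub> x \<nn> = (y \<ominus>\<^bsub>M\<^esub> x \<nn>) \<oplus>\<^bsub>M\<^esub> e \<odot>\<^bsub>M\<^esub> (x \<mm> \<ominus>\<^bsub>M\<^esub> y)"
      unfolding z_def using e(1) xc y(1) nc by (simp add: M.minus_eq M.a_ac)
    moreover have "y \<ominus>\<^bsub>M\<^esub> x \<nn> \<in> ideal_smult R M \<nn>" using y(2) n by blast
    moreover have "e \<odot>\<^bsub>M\<^esub> (x \<mm> \<ominus>\<^bsub>M\<^esub> y) \<in> ideal_smult R M \<nn>"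
      using e n xc y(1) by (intro ideal_smult_mem[OF \<nn>]) auto
    ultimately show ?thesis
      using submodule.m_closed[OF ideal_smult_submodule[OF \<nn>]] by simp
  qed
  moreover have "z \<ominus>\<^bsub>M\<^esub> x \<mm> \<in> ideal_smult R M \<mm>"
  proof -
    have "z \<ominus>\<^bsub>M\<^esub> x \<mm> = (y \<ominus>\<^bsub>M\<^esub> x \<mm>) \<ominus>\<^bsub>M\<^esub> e \<odot>\<^bsub>M\<^esub> (y \<ominus>\<^bsub>M\<^esub> x \<mm>)"
    proof -
      have "x \<mm> \<ominus>\<^bsub>M\<^esub> y = \<ominus>\<^bsub>M\<^esub> (y \<ominus>\<^bsub>M\<^esub> x \<mm>)"
        using xc y(1) by (simp add: M.minus_eq M.minus_add M.a_comm)
      then have "e \<odot>\<^bsub>M\<^esub> (x \<mm> \<ominus>\<^bsub>M\<^esub> y) = \<ominus>\<^bsub>M\<^esub> (e \<odot>\<^bsub>M\<^esub> (y \<ominus>\<^bsub>M\<^esub> x \<mm>))"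
        using e(1) xc y(1) by (simp add: smult_r_minus)
      then show ?thesis unfolding z_def using e(1) xc y(1) by (simp add: M.minus_eq M.a_ac)
    qed
    also have "\<dots> = (\<one>\<^bsub>R\<^esub> \<ominus>\<^bsub>R\<^esub> e) \<odot>\<^bsub>M\<^esub> (y \<ominus>\<^bsub>M\<^esub> x \<mm>)"
      using e(1) xc y(1) by (simp add: smult_diff)
    finally show ?thesis
      using ideal_smult_mem[OF maximalideal.axioms(1)[OF \<mm>] e(3)] xc y(1) by simp
  qed
  moreover have "z \<in> carrier M" unfolding z_def using e(1) xc y(1) by simp
  ultimately show ?case by blast
qed

section \<open>Avoiding few submodules over one residue field\<close>

text \<open>The points of the projective line through $x$ and $v$ are $x + av$, with $a$ running through
representatives of $R/\mathfrak m$, and the point $v$ at infinity.  Two of them span both $x$ and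
$v$ modulo $\mathfrak m M$.  So a submodule above $\mathfrak m M$ that does not contain both $x$
and $v$ contains at most one of the points, and mapping each point to a member of $C$ containing it
is injective.  The map is defined on the labels $a \in R/\mathfrak m$ and $\infty$, so that it is
injective even where points coincide because $x$ and $v$ are dependent.\<close>

lemma line_points_ordLeq:
  assumes \<mm>: "maximalideal \<mm> R" and x: "x \<in> carrier M" and v: "v \<in> carrier M"
    and C: "\<And>W. W \<in> C \<Longrightarrow> submodule R W M \<and> ideal_smult R M \<mm> \<subseteq> W \<and> \<not> {x, v} \<subseteq> W"
    and cover: "\<And>a. a \<in> carrier R \<Longrightarrow> x \<oplus>\<^bsub>M\<^esub> a \<odot>\<^bsub>M\<^esub> v \<in> \<Union>C" and cover_v: "v \<in> \<Union>C"
  shows "|carrier (R Quot \<mm>)| +c cone \<le>o |C|"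
proof -
  have id: "ideal \<mm> R" using maximalideal.axioms(1)[OF \<mm>] .
  obtain rep where rep: "\<And>K. K \<in> carrier (R Quot \<mm>) \<Longrightarrow> rep K \<in> carrier R"
    and distinct: "\<And>K L. \<lbrakk>K \<in> carrier (R Quot \<mm>); L \<in> carrier (R Quot \<mm>); rep K \<ominus>\<^bsub>R\<^esub> rep L \<in> \<mm>\<rbrakk> \<Longrightarrow> K = L"
    by (rule R.quotient_representatives[OF id]) blast
  define pt where "pt p = (case p of Inl K \<Rightarrow> x \<oplus>\<^bsub>M\<^esub> rep K \<odot>\<^bsub>M\<^esub> v | Inr _ \<Rightarrow> v)" for p :: "'a set + unit"
  let ?P = "carrier (R Quot \<mm>) <+> {()}"
  have "\<forall>p\<in>?P. \<exists>W\<in>C. pt p \<in> W"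
    using cover cover_v rep by (auto simp: pt_def)
  then obtain f where f: "\<And>p. p \<in> ?P \<Longrightarrow> f p \<in> C \<and> pt p \<in> f p" by metis
  have not_both: False if W: "W \<in> C" and "v \<in> W" "a \<in> carrier R" "x \<oplus>\<^bsub>M\<^esub> a \<odot>\<^bsub>M\<^esub> v \<in> W" for W a
  proof -
    interpret W: submodule R W M using C[OF W] by blast
    have "(x \<oplus>\<^bsub>M\<^esub> a \<odot>\<^bsub>M\<^esub> v) \<ominus>\<^bsub>M\<^esub> a \<odot>\<^bsub>M\<^esub> v \<in> W"
      using that by (intro submodule_minus[OF W.submodule_axioms]) auto
    then have "x \<in> W" using x v that(3) by (simp add: M.minus_eq M.a_assoc M.r_neg)
    then show False using C[OF W] \<open>v \<in> W\<close> by blast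
  qed
  have "inj_on f ?P"
  proof (rule inj_onI)
    fix p q assume pq: "p \<in> ?P" "q \<in> ?P" "f p = f q"
    then have W: "f p \<in> C" "pt p \<in> f p" "pt q \<in> f p" using f[of p] f[of q] by auto
    show "p = q"
    proof (cases p; cases q)
      fix K L assume KL: "p = Inl K" "q = Inl L"
      then have K: "K \<in> carrier (R Quot \<mm>)" "L \<in> carrier (R Quot \<mm>)" using pq by auto
      interpret W: submodule R "f p" M using C[OF W(1)] by blast
      have "(x \<oplus>\<^bsub>M\<^esub> rep K \<odot>\<^bsub>M\<^esub> v) \<ominus>\<^bsub>M\<^esub> (x \<oplus>\<^bsub>M\<^esub> rep L \<odot>\<^bsub>M\<^esub> v) \<in> f p"
        using W(2,3) KL by (intro submodule_minus[OF W.submodule_axioms]) (auto simp: pt_def)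
      also have "(x \<oplus>\<^bsub>M\<^esub> rep K \<odot>\<^bsub>M\<^esub> v) \<ominus>\<^bsub>M\<^esub> (x \<oplus>\<^bsub>M\<^esub> rep L \<odot>\<^bsub>M\<^esub> v)
          = (rep K \<ominus>\<^bsub>R\<^esub> rep L) \<odot>\<^bsub>M\<^esub> v"
      proof -
        define k l where kl: "k = rep K \<odot>\<^bsub>M\<^esub> v" "l = rep L \<odot>\<^bsub>M\<^esub> v"
        have kc: "k \<in> carrier M" "l \<in> carrier M" unfolding kl using rep K v by auto
        have "(x \<oplus>\<^bsub>M\<^esub> k) \<ominus>\<^bsub>M\<^esub> (x \<oplus>\<^bsub>M\<^esub> l) = (x \<oplus>\<^bsub>M\<^esub> \<ominus>\<^bsub>M\<^esub> x) \<oplus>\<^bsub>M\<^esub> (k \<ominus>\<^bsub>M\<^esub> l)"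
          using kc x by (simp add: M.minus_eq M.minus_add M.a_ac)
        then show ?thesis using kc x rep K v by (simp add: smult_diff kl M.r_neg)
      qed
      finally have diff: "(rep K \<ominus>\<^bsub>R\<^esub> rep L) \<odot>\<^bsub>M\<^esub> v \<in> f p" .
      have "rep K \<ominus>\<^bsub>R\<^esub> rep L \<in> \<mm>"
      proof (rule ccontr)
        assume "rep K \<ominus>\<^bsub>R\<^esub> rep L \<notin> \<mm>"
        then have "v \<in> f p"
          using mem_of_unit_multiple_mem[OF \<mm> W.submodule_axioms _ _ _ v diff] C[OF W(1)] rep K by auto
        then show False using not_both[OF W(1)] W(2) KL rep K by (auto simp: pt_def)
      qed
      then show "p = q" using distinct K KL by auto
    next
      fix K u assume "p = Inl K" "q = Inr u"
      then show "p = q" using not_both[OF W(1), of "rep K"] W pq rep by (auto simp: pt_def)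
    next
      fix K u assume "p = Inr u" "q = Inl K"
      then show "p = q" using not_both[OF W(1), of "rep K"] W pq rep by (auto simp: pt_def)
    qed auto
  qed
  moreover have "f ` ?P \<subseteq> C" using f by blast
  ultimately have "|?P| \<le>o |C|" using card_of_ordLeq[of ?P C] by blast
  then show ?thesis by (simp add: csum_def cone_def Field_card_of)
qed

text \<open>Induction on the generating set $A$.  If $x$ lies outside the members that fail to contain
$A$, and $v$ is a new generator, then no member contains both $x$ and $v$: if it
contains $A$ it misses $v$, and otherwise it misses $x$.  So if all points of the line through $x$
and $v$ were covered, there would be at least $|R/\mathfrak m| + 1$ members.\<close>

lemma exists_avoiding_element:
  assumes \<mm>: "maximalideal \<mm> R" and "finite A" and "A \<subseteq> carrier M"
    and "\<And>W. W \<in> C \<Longrightarrow> submodule R W M \<and> ideal_smult R M \<mm> \<subseteq> W \<and> \<not> A \<subseteq> W"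
    and "|C| <o |carrier (R Quot \<mm>)| +c cone"
  shows "\<exists>x\<in>carrier M. x \<notin> \<Union>C"
  using assms(2-)
proof (induction A arbitrary: C rule: finite_induct)
  case empty
  then have "C = {}" by blast
  then show ?case by auto
next
  case (insert v A)
  let ?C' = "{W \<in> C. \<not> A \<subseteq> W}"
  have "|?C'| \<le>o |C|" by (rule card_of_mono1) auto
  then have "|?C'| <o |carrier (R Quot \<mm>)| +c cone"
    using insert.prems(3) ordLeq_ordLess_trans by blast
  moreover have "submodule R W M \<and> ideal_smult R M \<mm> \<subseteq> W \<and> \<not> A \<subseteq> W" if "W \<in> ?C'" for W
    using insert.prems(2)[of W] that by simp
  moreover have "A \<subseteq> carrier M" using insert.prems(1) by simp
  ultimately have "\<exists>x\<in>carrier M. x \<notin> \<Union>?C'" by (intro insert.IH) 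
  then obtain x where x: "x \<in> carrier M" "x \<notin> \<Union>?C'" by (elim bexE)
  have vc: "v \<in> carrier M" using insert.prems by simp
  have "\<not> {x, v} \<subseteq> W" if "W \<in> C" for W
    using that insert.prems(2)[OF that] x(2) by blast
  then have C: "submodule R W M \<and> ideal_smult R M \<mm> \<subseteq> W \<and> \<not> {x, v} \<subseteq> W" if "W \<in> C" for W
    using that insert.prems(2)[OF that] by blast
  show ?case
  proof (rule ccontr)
    assume "\<not> ?thesis"
    then have all: "\<And>y. y \<in> carrier M \<Longrightarrow> y \<in> \<Union>C" by blast
    have "|carrier (R Quot \<mm>)| +c cone \<le>o |C|"
      by (rule line_points_ordLeq[OF \<mm> x(1) vc C]) (use all x(1) vc in auto)
    then show False using insert.prems(3) not_ordLess_ordLeq by blast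
  qed
qed

section \<open>Covering by the points of a projective line\<close>

text \<open>Modulo $U$, the module $M$ is a plane over $R/\mathfrak m$ with basis $x, y$.  The cover
consists of the preimages of its lines: those through $x + ay$, one for each representative $a$ of
$R/\mathfrak m$, and the line through $y$.\<close>

lemma exists_cover_by_lines:
  assumes \<mm>: "maximalideal \<mm> R" and U: "submodule R U M" and NU: "ideal_smult R M \<mm> \<subseteq> U"
    and xc: "x \<in> carrier M" and yc: "y \<in> carrier M"
    and gen: "span (insert x (span (insert y U))) = carrier M"
    and x: "x \<notin> span (insert y U)" and y: "y \<notin> U"
  shows "\<exists>C. proper_submodule_cover R M C \<and> |C| \<le>o |carrier (R Quot \<mm>)| +c cone"
proof -
  let ?N = "ideal_smult R M \<mm>"
  interpret \<mm>: maximalideal \<mm> R by (rule \<mm>)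
  interpret U: submodule R U M by (rule U)
  have sub: "insert w U \<subseteq> carrier M" if "w \<in> carrier M" for w using that U.subset by blast
  have S: "submodule R (span (insert w U)) M" if "w \<in> carrier M" for w
    by (rule span_is_submodule[OF sub[OF that]])
  have US: "U \<subseteq> span (insert w U)" "w \<in> span (insert w U)" if "w \<in> carrier M" for w
    using in_own_span[OF sub[OF that]] by auto
  have decomp: "\<exists>u\<in>U. \<exists>s\<in>carrier R. \<exists>r\<in>carrier R. v = (u \<oplus>\<^bsub>M\<^esub> s \<odot>\<^bsub>M\<^esub> y) \<oplus>\<^bsub>M\<^esub> r \<odot>\<^bsub>M\<^esub> x"
    if "v \<in> carrier M" for v
  proof -
    have "v \<in> span (insert x (span (insert y U)))" using gen that by simp
    then obtain u' r where u': "u' \<in> span (insert y U)" "r \<in> carrier R" "v = u' \<oplus>\<^bsub>M\<^esub> r \<odot>\<^bsub>M\<^esub> x"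
      unfolding span_insert_submodule[OF S[OF yc] xc] by blast
    then show ?thesis unfolding span_insert_submodule[OF U yc] by blast
  qed
  obtain rep where rep: "\<And>K. K \<in> carrier (R Quot \<mm>) \<Longrightarrow> rep K \<in> carrier R"
    and all_rep: "\<And>r. r \<in> carrier R \<Longrightarrow> \<exists>K\<in>carrier (R Quot \<mm>). r \<ominus>\<^bsub>R\<^esub> rep K \<in> \<mm>"
    by (rule R.quotient_representatives[OF \<mm>.is_ideal]) blast
  define dir where "dir p = (case p of Inl K \<Rightarrow> x \<oplus>\<^bsub>M\<^esub> rep K \<odot>\<^bsub>M\<^esub> y | Inr _ \<Rightarrow> y)" for p :: "'a set + unit"
  let ?I = "carrier (R Quot \<mm>) <+> {()}"
  define C where "C = (\<lambda>p. span (insert (dir p) U)) ` ?I"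
  have dirc: "dir p \<in> carrier M" if "p \<in> ?I" for p
    using that rep xc yc by (auto simp: dir_def)
  have "span (insert (dir p) U) \<noteq> carrier M" if p: "p \<in> ?I" for p
  proof (cases p)
    case (Inr u)
    then show ?thesis using x xc by (auto simp: dir_def)
  next
    case (Inl K)
    then have K: "rep K \<in> carrier R" using p rep by auto
    let ?w = "x \<oplus>\<^bsub>M\<^esub> rep K \<odot>\<^bsub>M\<^esub> y"
    have wc: "?w \<in> carrier M" using K xc yc by simp
    have "y \<notin> span (insert ?w U)"
    proof
      assume "y \<in> span (insert ?w U)"
      then obtain u t where ut: "u \<in> U" "t \<in> carrier R" "y = u \<oplus>\<^bsub>M\<^esub> t \<odot>\<^bsub>M\<^esub> ?w"
        unfolding span_insert_submodule[OF U wc] by blast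
      have uc: "u \<in> carrier M" using ut(1) U.subset by blast
      have y_eq: "y = (u \<oplus>\<^bsub>M\<^esub> (t \<otimes>\<^bsub>R\<^esub> rep K) \<odot>\<^bsub>M\<^esub> y) \<oplus>\<^bsub>M\<^esub> t \<odot>\<^bsub>M\<^esub> x"
      proof -
        have "u \<oplus>\<^bsub>M\<^esub> t \<odot>\<^bsub>M\<^esub> ?w = (u \<oplus>\<^bsub>M\<^esub> (t \<otimes>\<^bsub>R\<^esub> rep K) \<odot>\<^bsub>M\<^esub> y) \<oplus>\<^bsub>M\<^esub> t \<odot>\<^bsub>M\<^esub> x"
          using uc ut(2) K xc yc by (simp add: smult_r_distr smult_assoc1 M.a_ac)
        then show ?thesis using ut(3) by simp
      qed
      \<comment> \<open>If $t \in \mathfrak m$, the right-hand side lies in $U$, hence so does $y$;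
          otherwise the equation can be solved for $x$.\<close>
      show False
      proof (cases "t \<in> \<mm>")
        case True
        then have "t \<odot>\<^bsub>M\<^esub> x \<in> U" "(t \<otimes>\<^bsub>R\<^esub> rep K) \<odot>\<^bsub>M\<^esub> y \<in> U"
          using NU ideal_smult_mem[OF \<mm>.is_ideal] \<mm>.I_r_closed[OF _ K] xc yc by blast+
        then have "(u \<oplus>\<^bsub>M\<^esub> (t \<otimes>\<^bsub>R\<^esub> rep K) \<odot>\<^bsub>M\<^esub> y) \<oplus>\<^bsub>M\<^esub> t \<odot>\<^bsub>M\<^esub> x \<in> U"
          using ut(1) by (intro U.m_closed)
        then have "y \<in> U" using y_eq by simp
        then show False using y by simp
      next
        case False
        interpret S: submodule R "span (insert y U)" M by (rule S[OF yc])
        define q where "q = u \<oplus>\<^bsub>M\<^esub> (t \<otimes>\<^bsub>R\<^esub> rep K) \<odot>\<^bsub>M\<^esub> y"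
        have q: "q \<in> span (insert y U)"
          unfolding q_def using ut K US[OF yc] by (intro S.m_closed S.smult_closed) auto
        have qc: "q \<in> carrier M" using q S.subset by blast
        have "y \<ominus>\<^bsub>M\<^esub> q \<in> span (insert y U)"
          using q US(2)[OF yc] by (intro submodule_minus[OF S.submodule_axioms])
        moreover have "y \<ominus>\<^bsub>M\<^esub> q = t \<odot>\<^bsub>M\<^esub> x"
        proof -
          have "y \<ominus>\<^bsub>M\<^esub> q = (q \<oplus>\<^bsub>M\<^esub> t \<odot>\<^bsub>M\<^esub> x) \<ominus>\<^bsub>M\<^esub> q" using y_eq unfolding q_def by simp
          also have "\<dots> = (q \<oplus>\<^bsub>M\<^esub> \<ominus>\<^bsub>M\<^esub> q) \<oplus>\<^bsub>M\<^esub> t \<odot>\<^bsub>M\<^esub> x"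
            using qc ut(2) xc by (simp add: M.minus_eq M.a_ac)
          finally show ?thesis using qc ut(2) xc by (simp add: M.r_neg)
        qed
        ultimately have "t \<odot>\<^bsub>M\<^esub> x \<in> span (insert y U)" by simp
        moreover have "?N \<subseteq> span (insert y U)" using NU US(1)[OF yc] by blast
        ultimately have "x \<in> span (insert y U)"
          by (intro mem_of_unit_multiple_mem[OF \<mm> S.submodule_axioms _ ut(2) False xc])
        then show False using x by simp
      qed
    qed
    then show ?thesis using Inl yc by (auto simp: dir_def)
  qed
  moreover have covered: "\<exists>p\<in>?I. v \<in> span (insert (dir p) U)" if v: "v \<in> carrier M" for v
  proof -
    obtain u s r where u: "u \<in> U" and sr: "s \<in> carrier R" "r \<in> carrier R"
      and v_eq: "v = (u \<oplus>\<^bsub>M\<^esub> s \<odot>\<^bsub>M\<^esub> y) \<oplus>\<^bsub>M\<^esub> r \<odot>\<^bsub>M\<^esub> x" using decomp[OF v] by blast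
    have uc: "u \<in> carrier M" using u U.subset by blast
    show ?thesis
    proof (cases "r \<in> \<mm>")
      case True
      interpret S: submodule R "span (insert y U)" M by (rule S[OF yc])
      \<comment> \<open>For $r \in \mathfrak m$ the $x$-coordinate of $v$ vanishes, so $v$ lies on the line through $y$.\<close>
      have "u \<in> span (insert y U)" "r \<odot>\<^bsub>M\<^esub> x \<in> span (insert y U)"
        using u NU ideal_smult_mem[OF \<mm>.is_ideal True xc] US(1)[OF yc] by blast+
      then have "v \<in> span (insert y U)"
        unfolding v_eq by (intro S.m_closed S.smult_closed[OF sr(1) US(2)[OF yc]])
      then show ?thesis by (intro bexI[of _ "Inr ()"]) (auto simp: dir_def)
    next
      case False
      \<comment> \<open>Here $v$ lies on the line of slope $a = r^{-1} s$, taken modulo $\mathfrak m$.\<close>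
      obtain r' where r': "r' \<in> carrier R" "\<one>\<^bsub>R\<^esub> \<ominus>\<^bsub>R\<^esub> r' \<otimes>\<^bsub>R\<^esub> r \<in> \<mm>"
        by (rule R.maximalideal_inverse[OF \<mm> sr(2) False])
      obtain K where K: "K \<in> carrier (R Quot \<mm>)" "r' \<otimes>\<^bsub>R\<^esub> s \<ominus>\<^bsub>R\<^esub> rep K \<in> \<mm>"
        using all_rep[of "r' \<otimes>\<^bsub>R\<^esub> s"] r' sr by blast
      define a where "a = rep K"
      have a: "a \<in> carrier R" "r' \<otimes>\<^bsub>R\<^esub> s \<ominus>\<^bsub>R\<^esub> a \<in> \<mm>" using K rep unfolding a_def by auto
      let ?w = "x \<oplus>\<^bsub>M\<^esub> a \<odot>\<^bsub>M\<^esub> y"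
      have wc: "?w \<in> carrier M" using a xc yc by simp
      interpret S: submodule R "span (insert ?w U)" M by (rule S[OF wc])
      have "s \<ominus>\<^bsub>R\<^esub> r \<otimes>\<^bsub>R\<^esub> a = s \<otimes>\<^bsub>R\<^esub> (\<one>\<^bsub>R\<^esub> \<ominus>\<^bsub>R\<^esub> r' \<otimes>\<^bsub>R\<^esub> r) \<oplus>\<^bsub>R\<^esub> r \<otimes>\<^bsub>R\<^esub> (r' \<otimes>\<^bsub>R\<^esub> s \<ominus>\<^bsub>R\<^esub> a)"
        using sr r'(1) a(1) by algebra
      also have "\<dots> \<in> \<mm>" using sr r' a \<mm>.I_l_closed \<mm>.a_closed by blast
      finally have "(s \<ominus>\<^bsub>R\<^esub> r \<otimes>\<^bsub>R\<^esub> a) \<odot>\<^bsub>M\<^esub> y \<in> U"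
        using NU ideal_smult_mem[OF \<mm>.is_ideal _ yc] by blast
      then have "u \<oplus>\<^bsub>M\<^esub> (s \<ominus>\<^bsub>R\<^esub> r \<otimes>\<^bsub>R\<^esub> a) \<odot>\<^bsub>M\<^esub> y \<in> span (insert ?w U)"
        using U.m_closed[OF u] US(1)[OF wc] by blast
      moreover have "v = (u \<oplus>\<^bsub>M\<^esub> (s \<ominus>\<^bsub>R\<^esub> r \<otimes>\<^bsub>R\<^esub> a) \<odot>\<^bsub>M\<^esub> y) \<oplus>\<^bsub>M\<^esub> r \<odot>\<^bsub>M\<^esub> ?w"
      proof -
        define q where "q = r \<odot>\<^bsub>M\<^esub> (a \<odot>\<^bsub>M\<^esub> y)"
        have qc: "q \<in> carrier M" unfolding q_def using sr a yc by simp
        have "(s \<ominus>\<^bsub>R\<^esub> r \<otimes>\<^bsub>R\<^esub> a) \<odot>\<^bsub>M\<^esub> y = s \<odot>\<^bsub>M\<^esub> y \<ominus>\<^bsub>M\<^esub> q"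
          unfolding q_def using sr a yc by (simp add: smult_diff smult_assoc1)
        moreover have "r \<odot>\<^bsub>M\<^esub> ?w = r \<odot>\<^bsub>M\<^esub> x \<oplus>\<^bsub>M\<^esub> q"
          unfolding q_def using sr a xc yc by (simp add: smult_r_distr)
        moreover have "(u \<oplus>\<^bsub>M\<^esub> (s \<odot>\<^bsub>M\<^esub> y \<ominus>\<^bsub>M\<^esub> q)) \<oplus>\<^bsub>M\<^esub> (r \<odot>\<^bsub>M\<^esub> x \<oplus>\<^bsub>M\<^esub> q)
            = (u \<oplus>\<^bsub>M\<^esub> s \<odot>\<^bsub>M\<^esub> y) \<oplus>\<^bsub>M\<^esub> r \<odot>\<^bsub>M\<^esub> x \<oplus>\<^bsub>M\<^esub> (q \<oplus>\<^bsub>M\<^esub> \<ominus>\<^bsub>M\<^esub> q)"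
          using uc sr xc yc qc by (simp add: M.minus_eq M.a_ac)
        ultimately show ?thesis using v_eq uc sr xc yc qc by (simp add: M.r_neg)
      qed
      ultimately have "v \<in> span (insert ?w U)"
        using S.m_closed[OF _ S.smult_closed[OF sr(2) US(2)[OF wc]]] by simp
      then show ?thesis using K by (intro bexI[of _ "Inl K"]) (auto simp: dir_def a_def)
    qed
  qed
  moreover have "submodule R (span (insert (dir p) U)) M" if "p \<in> ?I" for p
    using S[OF dirc[OF that]] .
  ultimately have "submodule R W M \<and> W \<noteq> carrier M" if "W \<in> C" for W
    using that unfolding C_def by blast
  moreover from this have "\<Union>C \<subseteq> carrier M" by (blast dest: submodule.subset)
  moreover have "carrier M \<subseteq> \<Union>C" using covered unfolding C_def by blast
  ultimately have "proper_submodule_cover R M C"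
    unfolding proper_submodule_cover_def by blast
  moreover have "|C| \<le>o |?I|" unfolding C_def by (rule card_of_image)
  then have "|C| \<le>o |carrier (R Quot \<mm>)| +c cone" by (simp add: csum_def cone_def Field_card_of)
  ultimately show ?thesis by blast
qed

lemma exists_cover_if_noncyclic_modulo:
  assumes fg: "fin_gen_module R M" and \<mm>: "maximalideal \<mm> R"
    and two: "\<And>x. x \<in> carrier M \<Longrightarrow> span (insert x (ideal_smult R M \<mm>)) \<noteq> carrier M"
  shows "\<exists>C. proper_submodule_cover R M C \<and> |C| \<le>o |carrier (R Quot \<mm>)| +c cone"
proof -
  let ?N = "ideal_smult R M \<mm>"
  interpret N: submodule R ?N M
    by (rule ideal_smult_submodule[OF maximalideal.axioms(1)[OF \<mm>]])
  obtain A where A: "A \<subseteq> carrier M" "span (A \<union> ?N) = carrier M"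
    and irredundant: "\<And>z. z \<in> A \<Longrightarrow> z \<notin> span (A - {z} \<union> ?N)"
    by (rule exists_irredundant_generators_modulo[OF fg N.submodule_axioms]) blast
  have "A \<noteq> {}"
  proof
    assume "A = {}"
    then have "span (insert \<zero>\<^bsub>M\<^esub> ?N) = carrier M"
      using A by (simp add: insert_absorb)
    then show False using two by blast
  qed
  then obtain x where x: "x \<in> A" by blast
  have "A \<noteq> {x}"
    using A two[of x] by auto
  then obtain y where y: "y \<in> A" "y \<noteq> x" using x by blast
  define B where "B = A - {x, y} \<union> ?N"
  have Bc: "B \<subseteq> carrier M" using A N.subset unfolding B_def by auto
  have xc: "x \<in> carrier M" and yc: "y \<in> carrier M" using A x y by auto
  have insx: "insert y B = A - {x} \<union> ?N" and ins: "insert x (A - {x} \<union> ?N) = A \<union> ?N"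
    using x y unfolding B_def by auto
  have spy: "span (insert y (span B)) = span (A - {x} \<union> ?N)"
    unfolding insx[symmetric] using Bc yc by (intro span_idem_insert) simp
  have "insert x (A - {x} \<union> ?N) \<subseteq> carrier M" unfolding ins using A N.subset by blast
  then have gen: "span (insert x (span (insert y (span B)))) = carrier M"
    unfolding spy by (simp only: span_idem_insert ins A(2))
  have "B \<subseteq> A - {y} \<union> ?N" unfolding B_def by blast
  then have "y \<notin> span B" using span_is_monotone irredundant[OF y(1)] by blast
  moreover have "?N \<subseteq> span B" using in_own_span[OF Bc] unfolding B_def by blast
  moreover have "x \<notin> span (insert y (span B))" unfolding spy by (rule irredundant[OF x])
  ultimately show ?thesis
    using exists_cover_by_lines[OF \<mm> span_is_submodule[OF Bc] _ xc yc gen] by blast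
qed

section \<open>Dimension of the reduction\<close>

lemma reduction_add_rcos:
  assumes "ideal I R" and "x \<in> carrier M" and "y \<in> carrier M"
  shows "(ideal_smult R M I +>\<^bsub>M\<^esub> x) \<oplus>\<^bsub>reduction R M I\<^esub> (ideal_smult R M I +>\<^bsub>M\<^esub> y)
           = ideal_smult R M I +>\<^bsub>M\<^esub> (x \<oplus>\<^bsub>M\<^esub> y)"
proof -
  interpret abelian_subgroup "ideal_smult R M I" M
    by (rule submodule_abelian_subgroup) (rule ideal_smult_submodule[OF assms(1)])
  show ?thesis using assms(2,3) by (simp add: reduction_def a_rcos_sum)
qed

lemma carrier_reduction:
  "carrier (reduction R M I) = (\<lambda>x. ideal_smult R M I +>\<^bsub>M\<^esub> x) ` carrier M"
  by (auto simp: reduction_def A_RCOSETS_def')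

text \<open>Spans of the cosets of $A$ in $M/IM$ and of $A$ itself modulo $IM$ correspond, because
images and preimages of submodules under $M \to M/IM$ are submodules.\<close>

lemma reduction_gen_set_iff:
  assumes I: "ideal I R" and A: "A \<subseteq> carrier M"
  shows "module.span (R Quot I) (reduction R M I) ((\<lambda>x. ideal_smult R M I +>\<^bsub>M\<^esub> x) ` A)
           = carrier (reduction R M I)
         \<longleftrightarrow> span (A \<union> ideal_smult R M I) = carrier M"
proof -
  let ?N = "ideal_smult R M I" and ?Q = "reduction R M I"
  let ?\<pi> = "\<lambda>x. ?N +>\<^bsub>M\<^esub> x"
  interpret I: ideal I R by (rule I)
  interpret Q: module "R Quot I" ?Q by (rule reduction_module[OF I])
  interpret N: submodule R ?N M by (rule ideal_smult_submodule[OF I])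
  interpret N: abelian_subgroup ?N M
    by (rule submodule_abelian_subgroup) (rule N.submodule_axioms)
  have zero: "?\<pi> n = \<zero>\<^bsub>?Q\<^esub>" if "n \<in> ?N" for n
    using that by (simp add: reduction_def N.a_rcos_const)
  have coset: "I +>\<^bsub>R\<^esub> r \<in> carrier (R Quot I)" if "r \<in> carrier R" for r
    using that by (auto simp: FactRing_def A_RCOSETS_def')
  have \<pi>A: "?\<pi> ` A \<subseteq> carrier ?Q" using A by (auto simp: carrier_reduction)
  have AN: "A \<union> ?N \<subseteq> carrier M" using A N.subset by blast
  show ?thesis
  proof
    assume gen: "Q.span (?\<pi> ` A) = carrier ?Q"
    let ?L = "span (A \<union> ?N)"
    interpret L: submodule R ?L M by (rule span_is_submodule[OF AN])
    have "submodule (R Quot I) (?\<pi> ` ?L) ?Q"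
    proof (intro submodule.intro Q.module_axioms)
      show "?\<pi> ` ?L \<subseteq> carrier ?Q" using L.subset by (auto simp: carrier_reduction)
      show "\<zero>\<^bsub>?Q\<^esub> \<in> ?\<pi> ` ?L" using zero[OF N.zero_closed] L.zero_closed by (metis imageI)
      show "v \<oplus>\<^bsub>?Q\<^esub> w \<in> ?\<pi> ` ?L" if vw: "v \<in> ?\<pi> ` ?L" "w \<in> ?\<pi> ` ?L" for v w
      proof -
        obtain x y where xy: "x \<in> ?L" "y \<in> ?L" "v = ?\<pi> x" "w = ?\<pi> y" using vw by blast
        then have "v \<oplus>\<^bsub>?Q\<^esub> w = ?\<pi> (x \<oplus>\<^bsub>M\<^esub> y)"
          using reduction_add_rcos[OF I] L.subset by blast
        then show ?thesis using L.m_closed xy by blast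
      qed
      show "c \<odot>\<^bsub>?Q\<^esub> v \<in> ?\<pi> ` ?L" if cv: "c \<in> carrier (R Quot I)" "v \<in> ?\<pi> ` ?L" for c v
      proof -
        obtain r where r: "r \<in> carrier R" "c = I +>\<^bsub>R\<^esub> r"
          using cv(1) by (auto simp: FactRing_def A_RCOSETS_def')
        obtain x where x: "x \<in> ?L" "v = ?\<pi> x" using cv(2) by blast
        then have "c \<odot>\<^bsub>?Q\<^esub> v = ?\<pi> (r \<odot>\<^bsub>M\<^esub> x)"
          using reduction_smult_rcos[OF I r(1)] r L.subset by blast
        then show ?thesis using L.smult_closed r x by blast
      qed
    qed
    then have "Q.span (?\<pi> ` A) \<subseteq> ?\<pi> ` ?L"
      using in_own_span[OF AN] by (intro Q.span_is_subset) blast+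
    then have sub: "carrier ?Q \<subseteq> ?\<pi> ` ?L" using gen by simp
    have "x \<in> ?L" if x: "x \<in> carrier M" for x
    proof -
      have "?\<pi> x \<in> ?\<pi> ` ?L" using sub x by (auto simp: carrier_reduction)
      then obtain y where y: "y \<in> ?L" "?\<pi> x = ?\<pi> y" by blast
      have "x \<in> ?\<pi> y" using N.a_rcos_self[OF x] y(2) by simp
      then obtain n where "n \<in> ?N" "x = n \<oplus>\<^bsub>M\<^esub> y" by (auto simp: a_r_coset_def')
      then show ?thesis using y in_own_span[OF AN] by blast
    qed
    then show "?L = carrier M" using L.subset by blast
  next
    assume gen: "span (A \<union> ?N) = carrier M"
    let ?T = "Q.span (?\<pi> ` A)"
    interpret T: submodule "R Quot I" ?T ?Q by (rule Q.span_is_submodule[OF \<pi>A])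
    let ?P = "{x \<in> carrier M. ?\<pi> x \<in> ?T}"
    have "submodule R ?P M"
    proof (intro submodule.intro module_axioms)
      show "\<zero>\<^bsub>M\<^esub> \<in> ?P" using zero[OF N.zero_closed] T.zero_closed by simp
      show "v \<oplus>\<^bsub>M\<^esub> w \<in> ?P" if "v \<in> ?P" "w \<in> ?P" for v w
        using that reduction_add_rcos[OF I, of v w] T.m_closed[of "?\<pi> v" "?\<pi> w"] by simp
      show "c \<odot>\<^bsub>M\<^esub> v \<in> ?P" if "c \<in> carrier R" "v \<in> ?P" for c v
        using that reduction_smult_rcos[OF I, of c v] T.smult_closed[OF coset, of c "?\<pi> v"] by simp
    qed auto
    moreover have "A \<union> ?N \<subseteq> ?P"
    proof
      fix x assume "x \<in> A \<union> ?N"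
      then show "x \<in> ?P"
      proof
        assume "x \<in> A"
        then show ?thesis using A Q.in_own_span[OF \<pi>A] by blast
      next
        assume "x \<in> ?N"
        then show ?thesis using zero[of x] T.zero_closed N.subset by auto
      qed
    qed
    ultimately have "span (A \<union> ?N) \<subseteq> ?P" by (intro span_is_subset)
    then have "carrier ?Q \<subseteq> ?T" using gen by (auto simp: carrier_reduction)
    then show "?T = carrier ?Q" using T.subset by blast
  qed
qed

text \<open>The dimension is the least size of a finite generating set.  It is attained because $M$ is
finitely generated, so it is at most $1$ exactly if one element, possibly zero, generates.\<close>

lemma dim_reduction_ge_2_iff:
  assumes fg: "fin_gen_module R M" and \<mm>: "maximalideal \<mm> R"
  shows "vectorspace.dim (R Quot \<mm>) (reduction R M \<mm>) \<ge> 2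
           \<longleftrightarrow> (\<forall>x\<in>carrier M. span (insert x (ideal_smult R M \<mm>)) \<noteq> carrier M)"
proof -
  let ?N = "ideal_smult R M \<mm>" and ?Q = "reduction R M \<mm>"
  let ?\<pi> = "\<lambda>x. ?N +>\<^bsub>M\<^esub> x"
  interpret \<mm>: maximalideal \<mm> R by (rule \<mm>)
  interpret Q: vectorspace "R Quot \<mm>" ?Q by (rule reduction_vectorspace[OF \<mm>])
  interpret N: submodule R ?N M by (rule ideal_smult_submodule[OF \<mm>.is_ideal])
  note gen_iff = reduction_gen_set_iff[OF \<mm>.is_ideal]
  let ?G = "\<lambda>n. \<exists>X. finite X \<and> card X = n \<and> X \<subseteq> carrier ?Q \<and> Q.span X = carrier ?Q"
  have dim: "Q.dim = (LEAST n. ?G n)" by (simp add: Q.dim_def)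
  obtain A where A: "finite A" "A \<subseteq> carrier M" "span (A \<union> ?N) = carrier M"
    by (rule exists_irredundant_generators_modulo[OF fg N.submodule_axioms])
  have "?G (card (?\<pi> ` A))"
    using A gen_iff[of A] by (intro exI[of _ "?\<pi> ` A"]) (auto simp: carrier_reduction)
  then have "?G Q.dim" unfolding dim by (rule LeastI)
  then obtain X where X: "finite X" "card X = Q.dim" "X \<subseteq> carrier ?Q" "Q.span X = carrier ?Q"
    by blast
  have "Q.dim < 2 \<longleftrightarrow> (\<exists>x\<in>carrier M. span (insert x ?N) = carrier M)"
  proof
    assume "Q.dim < 2"
    then have card: "card X \<le> Suc 0" using X(2) by simp
    obtain B where B: "B \<subseteq> carrier M" "X = ?\<pi> ` B"
      using X(3) by (auto simp: carrier_reduction subset_image_iff)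
    then have "\<exists>x\<in>carrier M. X \<subseteq> ?\<pi> ` {x}"
    proof (cases "B = {}")
      case True
      then show ?thesis using B by auto
    next
      case False
      then obtain x where x: "x \<in> B" by blast
      have "\<forall>a\<in>X. \<forall>b\<in>X. a = b" using card card_le_Suc0_iff_eq[OF X(1)] by blast
      then have "X \<subseteq> {?\<pi> x}" using B(2) x by blast
      then show ?thesis using x B by auto
    qed
    then obtain x where x: "x \<in> carrier M" "X \<subseteq> ?\<pi> ` {x}" by blast
    have "?\<pi> ` {x} \<subseteq> carrier ?Q" using x(1) by (auto simp: carrier_reduction)
    then have "Q.span (?\<pi> ` {x}) = carrier ?Q"
      using Q.span_is_monotone[OF x(2)] X(4) Q.span_is_subset2[of "?\<pi> ` {x}"] by blast
    then have "span ({x} \<union> ?N) = carrier M" using gen_iff[of "{x}"] x(1) by simp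
    then show "\<exists>x\<in>carrier M. span (insert x ?N) = carrier M" using x(1) by auto
  next
    assume "\<exists>x\<in>carrier M. span (insert x ?N) = carrier M"
    then obtain x where x: "x \<in> carrier M" "span (insert x ?N) = carrier M" by blast
    then have "Q.span (?\<pi> ` {x}) = carrier ?Q" using gen_iff[of "{x}"] by simp
    then have "?G 1" using x(1) by (intro exI[of _ "?\<pi> ` {x}"]) (auto simp: carrier_reduction)
    then have "Q.dim \<le> 1" unfolding dim by (rule Least_le)
    then show "Q.dim < 2" by simp
  qed
  then show ?thesis by (meson not_le)
qed

section \<open>The covering number\<close>

text \<open>The family \<open>D \<mm>\<close> consists of those $W + \mathfrak m M$, for $W$ in the cover, that
are still proper.  Avoiding \<open>D \<mm>\<close> for each $\mathfrak m$ separately and gluing the avoiding elements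
yields an element outside the cover.\<close>

lemma proper_submodule_cover_lower_bound:
  assumes fin: "finite {\<mm>. maximalideal \<mm> R}" and fg: "fin_gen_module R M"
    and C: "proper_submodule_cover R M C"
  shows "\<exists>\<mm>. maximalideal \<mm> R \<and> (\<forall>x\<in>carrier M. span (insert x (ideal_smult R M \<mm>)) \<noteq> carrier M)
           \<and> |carrier (R Quot \<mm>)| +c cone \<le>o |C|"
proof (rule ccontr)
  assume none: "\<not> ?thesis"
  define D where "D \<mm> = {L. L \<noteq> carrier M \<and> (\<exists>W\<in>C. L = span (W \<union> ideal_smult R M \<mm>))}" for \<mm>
  have Cs: "submodule R W M" "W \<noteq> carrier M" if "W \<in> C" for W
    using C that unfolding proper_submodule_cover_def by auto
  have avoid: "\<exists>x\<in>carrier M. x \<notin> \<Union>(D \<mm>)" if \<mm>: "maximalideal \<mm> R" for \<mm>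
  proof -
    let ?N = "ideal_smult R M \<mm>"
    have id: "ideal \<mm> R" using maximalideal.axioms(1)[OF \<mm>] .
    interpret N: submodule R ?N M by (rule ideal_smult_submodule[OF id])
    have D: "submodule R L M \<and> ?N \<subseteq> L \<and> L \<noteq> carrier M" if L: "L \<in> D \<mm>" for L
    proof -
      obtain W where W: "W \<in> C" "L = span (W \<union> ?N)" using L unfolding D_def by blast
      have sub: "W \<union> ?N \<subseteq> carrier M" using submodule.subset[OF Cs(1)[OF W(1)]] N.subset by blast
      show ?thesis
        using L span_is_submodule[OF sub] in_own_span[OF sub] unfolding W(2) D_def by blast
    qed
    show ?thesis
    proof (cases "\<exists>x\<in>carrier M. span (insert x ?N) = carrier M")
      case True
      then obtain x where x: "x \<in> carrier M" "span (insert x ?N) = carrier M" by blast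
      \<comment> \<open>A generator modulo $\mathfrak m M$ avoids every proper submodule above $\mathfrak m M$.\<close>
      have "x \<notin> L" if L: "L \<in> D \<mm>" for L
      proof
        assume "x \<in> L"
        then have "span (insert x ?N) \<subseteq> L" using D[OF L] by (intro span_is_subset) auto
        then show False using x(2) D[OF L] submodule.subset[of R L M] by auto
      qed
      then show ?thesis using x(1) by blast
    next
      case False
      have "\<not> |carrier (R Quot \<mm>)| +c cone \<le>o |C|" using none \<mm> False by blast
      then have "|C| <o |carrier (R Quot \<mm>)| +c cone"
        by (rule not_ordLeq_iff_ordLess[OF card_of_Well_order
              card_order_on_well_order_on[OF Card_order_csum], THEN iffD1])
      moreover have "D \<mm> \<subseteq> (\<lambda>W. span (W \<union> ?N)) ` C" unfolding D_def by blast
      then have "|D \<mm>| \<le>o |C|" by (rule ordLeq_transitive[OF card_of_mono1 card_of_image])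
      ultimately have small: "|D \<mm>| <o |carrier (R Quot \<mm>)| +c cone"
        using ordLeq_ordLess_trans by blast
      obtain A where A: "finite A" "A \<subseteq> carrier M" "span (A \<union> ?N) = carrier M"
        by (rule exists_irredundant_generators_modulo[OF fg N.submodule_axioms])
      have "\<not> A \<subseteq> L" if L: "L \<in> D \<mm>" for L
      proof
        assume "A \<subseteq> L"
        then have "span (A \<union> ?N) \<subseteq> L" using D[OF L] by (intro span_is_subset) auto
        then show False using A(3) D[OF L] submodule.subset[of R L M] by auto
      qed
      then show ?thesis using exists_avoiding_element[OF \<mm> A(1,2) _ small] D by blast
    qed
  qed
  then obtain x where x: "\<And>\<mm>. maximalideal \<mm> R \<Longrightarrow> x \<mm> \<in> carrier M \<and> x \<mm> \<notin> \<Union>(D \<mm>)" by metis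
  then obtain y where y: "y \<in> carrier M"
    and cong: "\<And>\<mm>. maximalideal \<mm> R \<Longrightarrow> y \<ominus>\<^bsub>M\<^esub> x \<mm> \<in> ideal_smult R M \<mm>"
    using exists_simultaneous_congruence[OF fin, of x] by auto
  obtain W where W: "W \<in> C" "y \<in> W" using C y unfolding proper_submodule_cover_def by blast
  obtain \<mm> where \<mm>: "maximalideal \<mm> R" and ne: "span (W \<union> ideal_smult R M \<mm>) \<noteq> carrier M"
    using exists_proper_reduction[OF fg Cs[OF W(1)]] by blast
  let ?N = "ideal_smult R M \<mm>"
  have sub: "W \<union> ?N \<subseteq> carrier M"
    using submodule.subset[OF Cs(1)[OF W(1)]]
      submodule.subset[OF ideal_smult_submodule[OF maximalideal.axioms(1)[OF \<mm>]]] by blast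
  have "y \<in> span (W \<union> ?N)" "y \<ominus>\<^bsub>M\<^esub> x \<mm> \<in> span (W \<union> ?N)"
    using W(2) cong[OF \<mm>] in_own_span[OF sub] by blast+
  then have "y \<ominus>\<^bsub>M\<^esub> (y \<ominus>\<^bsub>M\<^esub> x \<mm>) \<in> span (W \<union> ?N)"
    by (rule submodule_minus[OF span_is_submodule[OF sub]])
  moreover have "y \<ominus>\<^bsub>M\<^esub> (y \<ominus>\<^bsub>M\<^esub> x \<mm>) = x \<mm>"
  proof -
    have xc: "x \<mm> \<in> carrier M" using x[OF \<mm>] by simp
    have "y \<ominus>\<^bsub>M\<^esub> (y \<ominus>\<^bsub>M\<^esub> x \<mm>) = (y \<oplus>\<^bsub>M\<^esub> \<ominus>\<^bsub>M\<^esub> y) \<oplus>\<^bsub>M\<^esub> x \<mm>"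
      using xc y by (simp add: M.minus_eq M.minus_add M.a_assoc)
    then show ?thesis using xc y by (simp add: M.r_neg)
  qed
  moreover have "span (W \<union> ?N) \<in> D \<mm>" using W(1) ne unfolding D_def by blast
  ultimately show False using x[OF \<mm>] by auto
qed

lemma cyclic_cover:
  assumes "\<not> cyclic_module R M"
  shows "proper_submodule_cover R M ((\<lambda>x. span {x}) ` carrier M)"
  unfolding proper_submodule_cover_def
proof (intro conjI ballI)
  have sub: "submodule R (span {x}) M" "x \<in> span {x}" if "x \<in> carrier M" for x
    using that span_is_submodule[of "{x}"] in_own_span[of "{x}"] by auto
  show "\<Union> ((\<lambda>x. span {x}) ` carrier M) = carrier M"
    using sub submodule.subset[OF sub(1)] by blast
  fix W assume "W \<in> (\<lambda>x. span {x}) ` carrier M"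
  then show "submodule R W M" "W \<noteq> carrier M"
    using sub(1) assms unfolding cyclic_module_def by auto
qed

end

theorem theorem2p8:
  fixes R :: "('a, 'r) ring_scheme" and M :: "('a, 'b, 'm) module_scheme"
    and S :: "'a set set"
  assumes "cring R"
    and "finite {\<mm>. maximalideal \<mm> R}"
    and "module R M"
    and "fin_gen_module R M"
    and S: "S = {\<mm>. maximalideal \<mm> R \<and> vectorspace.dim (R Quot \<mm>) (reduction R M \<mm>) \<ge> 2}"
  shows "(S \<noteq> {} \<longrightarrow>
            (\<exists>C. proper_submodule_cover R M C) \<and>
            covering_number R M =o min_card {|carrier (R Quot \<mm>)| +c cone | \<mm>. \<mm> \<in> S})
       \<and> (S = {} \<longrightarrow> cyclic_module R M)"
proof -
  interpret module R M by fact
  have S_iff: "\<mm> \<in> S \<longleftrightarrow> maximalideal \<mm> R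
      \<and> (\<forall>x\<in>carrier M. span (insert x (ideal_smult R M \<mm>)) \<noteq> carrier M)" for \<mm>
    using dim_reduction_ge_2_iff[OF assms(4), of \<mm>] unfolding S by blast
  have lower: "\<exists>\<mm>\<in>S. |carrier (R Quot \<mm>)| +c cone \<le>o |C|" if "proper_submodule_cover R M C" for C
    using proper_submodule_cover_lower_bound[OF assms(2,4) that] S_iff by blast
  let ?Y = "{|carrier (R Quot \<mm>)| +c cone | \<mm>. \<mm> \<in> S}"
  let ?X = "{|C| | C. proper_submodule_cover R M C}"
  show ?thesis
  proof (intro conjI impI)
    assume "S = {}"
    then show "cyclic_module R M" using lower[OF cyclic_cover] by blast
  next
    assume "S \<noteq> {}"
    have Y: "min_card ?Y \<in> ?Y" "\<And>s. s \<in> ?Y \<Longrightarrow> min_card ?Y \<le>o s"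
      by (rule min_card; use \<open>S \<noteq> {}\<close> Card_order_csum in blast)+
    then obtain \<mm> where \<mm>: "\<mm> \<in> S" "min_card ?Y = |carrier (R Quot \<mm>)| +c cone" by blast
    have "maximalideal \<mm> R" "\<And>x. x \<in> carrier M \<Longrightarrow> span (insert x (ideal_smult R M \<mm>)) \<noteq> carrier M"
      using \<mm>(1) unfolding S_iff by blast+
    from exists_cover_if_noncyclic_modulo[OF assms(4) this]
    obtain C0 where C0: "proper_submodule_cover R M C0" "|C0| \<le>o min_card ?Y"
      unfolding \<mm>(2) by blast
    show "\<exists>C. proper_submodule_cover R M C" using C0 by blast
    have X: "covering_number R M \<in> ?X" "\<And>s. s \<in> ?X \<Longrightarrow> covering_number R M \<le>o s"
      unfolding covering_number_def by (rule min_card; use C0 card_of_Card_order in blast)+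
    have "covering_number R M \<le>o min_card ?Y"
      using X(2)[of "|C0|"] C0 ordLeq_transitive by blast
    moreover have "min_card ?Y \<le>o covering_number R M"
    proof -
      obtain C where C: "proper_submodule_cover R M C" "covering_number R M = |C|" using X(1) by blast
      then obtain \<nn> where "\<nn> \<in> S" "|carrier (R Quot \<nn>)| +c cone \<le>o covering_number R M"
        using lower[OF C(1)] by auto
      then show ?thesis using Y(2) ordLeq_transitive by blast
    qed
    ultimately show "covering_number R M =o min_card ?Y" by (simp add: ordIso_iff_ordLeq)
  qed
qed

end
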